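(* Let $\mathcal E\xrightarrow{Q}\mathcal D\xrightarrow{P}\mathcal B$ be a composable pair of Grothendieck fibrations. Let cleavages on $P$ and $Q$ be fixed, and consider the composite cleavage on $P\circ Q$. Then the following correspondence is (with the structure isomorphisms coming from the cleavages) a pseudo-functor $\Xi_Q\colon\mathcal B^{op}\to\mathit{FIB}_c$: an object $A$ is sent to the restriction $Q_A\colon\mathcal E_A\to\mathcal D_A$, and an arrow $f\colon A\to B$ is sent to the commutative square $$(f^*\colon\mathcal E_B\to\mathcal E_A,\; f^*\colon\mathcal D_B\to\mathcal D_A)\colon Q_B\to Q_A$$ formed by the inverse image functors of $P\circ Q$ and $P$ along $f$.
   Context: $\mathit{FIB}_c$ is the 2-category whose objects are Grothendieck fibrations (over arbitrary bases), whose morphisms are Cartesian morphisms of fibrations, i.e. commutative squares of functors whose total component preserves Cartesian arrows, and whose 2-cells are pairs of natural transformations, one between the total functors lying over one between the base functors. $\mathcal D_A$ is the fibre of $P$ over $A$ and $\mathcal E_A$ the fibre of $P\circ Q$ over $A$. A cleavage is a choice, for each arrow $f$ of the base and each object $E$ over its codomain, of a Cartesian lift $\bar f_E\colon f^*E\to E$; it determines inverse image functors $f^*$ between fibres, with canonical isomorphisms $f^*g^*\cong(gf)^*$ and $\mathrm{Id}\cong 1_A^*$ defined by universality. The composite cleavage on $P\circ Q$: the lift of $f\colon A\to B$ at $E$ is the chosen $Q$-Cartesian lift at $E$ of the chosen $P$-Cartesian lift $\bar f_{Q(E)}\colon f^*Q(E)\to Q(E)$ of $f$ at $Q(E)$.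 *)

theory Defs
  imports "HOL-Library.FuncSet"
begin

section \<open>Categories, functors, natural transformations\<close>

text \<open>Composites \<open>g \<cdot>\<^bsub>C\<^esub> f\<close> are in applicative order: first \<open>f\<close>, then \<open>g\<close>.\<close>

record ('o, 'a) cat =
  Ob :: "'o set"
  Ar :: "'a set"
  src :: "'a \<Rightarrow> 'o"
  tgt :: "'a \<Rightarrow> 'o"
  ide :: "'o \<Rightarrow> 'a"
  cmp :: "'a \<Rightarrow> 'a \<Rightarrow> 'a" (infixr "\<cdot>\<index>" 70)

locale category =
  fixes C :: "('o, 'a) cat" (structure)
  assumes src_in: "f \<in> Ar C \<Longrightarrow> src C f \<in> Ob C"
    and tgt_in: "f \<in> Ar C \<Longrightarrow> tgt C f \<in> Ob C"
    and ide_in: "A \<in> Ob C \<Longrightarrow> ide C A \<in> Ar C"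
    and src_ide: "A \<in> Ob C \<Longrightarrow> src C (ide C A) = A"
    and tgt_ide: "A \<in> Ob C \<Longrightarrow> tgt C (ide C A) = A"
    and cmp_in: "\<lbrakk>f \<in> Ar C; g \<in> Ar C; tgt C f = src C g\<rbrakk> \<Longrightarrow> g \<cdot> f \<in> Ar C"
    and src_cmp: "\<lbrakk>f \<in> Ar C; g \<in> Ar C; tgt C f = src C g\<rbrakk> \<Longrightarrow> src C (g \<cdot> f) = src C f"
    and tgt_cmp: "\<lbrakk>f \<in> Ar C; g \<in> Ar C; tgt C f = src C g\<rbrakk> \<Longrightarrow> tgt C (g \<cdot> f) = tgt C g"
    and cmp_ide_right: "f \<in> Ar C \<Longrightarrow> f \<cdot> ide C (src C f) = f"
    and cmp_ide_left: "f \<in> Ar C \<Longrightarrow> ide C (tgt C f) \<cdot> f = f"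
    and cmp_assoc: "\<lbrakk>f \<in> Ar C; g \<in> Ar C; h \<in> Ar C; tgt C f = src C g; tgt C g = src C h\<rbrakk>
      \<Longrightarrow> (h \<cdot> g) \<cdot> f = h \<cdot> (g \<cdot> f)"

definition opposite :: "('o, 'a) cat \<Rightarrow> ('o, 'a) cat" where
  "opposite C = C\<lparr>src := tgt C, tgt := src C, cmp := (\<lambda>g f. f \<cdot>\<^bsub>C\<^esub> g)\<rparr>"

definition iso_arrow :: "('o, 'a) cat \<Rightarrow> 'a \<Rightarrow> bool" where
  "iso_arrow C f \<longleftrightarrow> f \<in> Ar C \<and>
     (\<exists>g \<in> Ar C. src C g = tgt C f \<and> tgt C g = src C f \<and>
        g \<cdot>\<^bsub>C\<^esub> f = ide C (src C f) \<and> f \<cdot>\<^bsub>C\<^esub> g = ide C (tgt C f))"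

text \<open>
  Functors and natural transformations carry their source and target.  Their underlying
  functions are required to be extensional on the source category, so that HOL equality of
  functors and of natural transformations is the mathematical one.
\<close>

record ('o1, 'a1, 'o2, 'a2) fnctr =
  Src :: "('o1, 'a1) cat"
  Tgt :: "('o2, 'a2) cat"
  omap :: "'o1 \<Rightarrow> 'o2"
  amap :: "'a1 \<Rightarrow> 'a2"

locale is_functor = S: category "Src F" + T: category "Tgt F"
  for F :: "('o1, 'a1, 'o2, 'a2) fnctr" +
  assumes omap_in: "A \<in> Ob (Src F) \<Longrightarrow> omap F A \<in> Ob (Tgt F)"
    and amap_in: "f \<in> Ar (Src F) \<Longrightarrow> amap F f \<in> Ar (Tgt F)"
    and src_amap: "f \<in> Ar (Src F) \<Longrightarrow> src (Tgt F) (amap F f) = omap F (src (Src F) f)"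
    and tgt_amap: "f \<in> Ar (Src F) \<Longrightarrow> tgt (Tgt F) (amap F f) = omap F (tgt (Src F) f)"
    and amap_ide: "A \<in> Ob (Src F) \<Longrightarrow> amap F (ide (Src F) A) = ide (Tgt F) (omap F A)"
    and amap_cmp: "\<lbrakk>f \<in> Ar (Src F); g \<in> Ar (Src F); tgt (Src F) f = src (Src F) g\<rbrakk>
      \<Longrightarrow> amap F (g \<cdot>\<^bsub>Src F\<^esub> f) = amap F g \<cdot>\<^bsub>Tgt F\<^esub> amap F f"
    and omap_ext: "omap F \<in> extensional (Ob (Src F))"
    and amap_ext: "amap F \<in> extensional (Ar (Src F))"

definition id_fnctr :: "('o, 'a) cat \<Rightarrow> ('o, 'a, 'o, 'a) fnctr" where
  "id_fnctr C = \<lparr>Src = C, Tgt = C, omap = (\<lambda>A \<in> Ob C. A), amap = (\<lambda>f \<in> Ar C. f)\<rparr>"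

definition fcomp ::
  "('o2, 'a2, 'o3, 'a3) fnctr \<Rightarrow> ('o1, 'a1, 'o2, 'a2) fnctr \<Rightarrow> ('o1, 'a1, 'o3, 'a3) fnctr"
  (infixr "\<circ>\<^sub>F" 70) where
  "G \<circ>\<^sub>F F = \<lparr>Src = Src F, Tgt = Tgt G,
     omap = compose (Ob (Src F)) (omap G) (omap F),
     amap = compose (Ar (Src F)) (amap G) (amap F)\<rparr>"

record ('o1, 'a1, 'o2, 'a2) nattrans =
  nsrc :: "('o1, 'a1, 'o2, 'a2) fnctr"
  ntgt :: "('o1, 'a1, 'o2, 'a2) fnctr"
  comps :: "'o1 \<Rightarrow> 'a2"

locale natural_transformation = F: is_functor "nsrc \<alpha>" + G: is_functor "ntgt \<alpha>"
  for \<alpha> :: "('o1, 'a1, 'o2, 'a2) nattrans" +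
  assumes same_Src: "Src (nsrc \<alpha>) = Src (ntgt \<alpha>)"
    and same_Tgt: "Tgt (nsrc \<alpha>) = Tgt (ntgt \<alpha>)"
    and comps_in: "A \<in> Ob (Src (nsrc \<alpha>)) \<Longrightarrow> comps \<alpha> A \<in> Ar (Tgt (nsrc \<alpha>))"
    and src_comps: "A \<in> Ob (Src (nsrc \<alpha>)) \<Longrightarrow> src (Tgt (nsrc \<alpha>)) (comps \<alpha> A) = omap (nsrc \<alpha>) A"
    and tgt_comps: "A \<in> Ob (Src (nsrc \<alpha>)) \<Longrightarrow> tgt (Tgt (nsrc \<alpha>)) (comps \<alpha> A) = omap (ntgt \<alpha>) A"
    and naturality: "f \<in> Ar (Src (nsrc \<alpha>)) \<Longrightarrow>
      comps \<alpha> (tgt (Src (nsrc \<alpha>)) f) \<cdot>\<^bsub>Tgt (nsrc \<alpha>)\<^esub> amap (nsrc \<alpha>) f =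
      amap (ntgt \<alpha>) f \<cdot>\<^bsub>Tgt (nsrc \<alpha>)\<^esub> comps \<alpha> (src (Src (nsrc \<alpha>)) f)"
    and comps_ext: "comps \<alpha> \<in> extensional (Ob (Src (nsrc \<alpha>)))"

definition id_nat :: "('o1, 'a1, 'o2, 'a2) fnctr \<Rightarrow> ('o1, 'a1, 'o2, 'a2) nattrans" where
  "id_nat F = \<lparr>nsrc = F, ntgt = F, comps = (\<lambda>A \<in> Ob (Src F). ide (Tgt F) (omap F A))\<rparr>"

definition vcomp_nat ::
  "('o1, 'a1, 'o2, 'a2) nattrans \<Rightarrow> ('o1, 'a1, 'o2, 'a2) nattrans \<Rightarrow> ('o1, 'a1, 'o2, 'a2) nattrans"
  where
  "vcomp_nat \<beta> \<alpha> = \<lparr>nsrc = nsrc \<alpha>, ntgt = ntgt \<beta>,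
     comps = (\<lambda>A \<in> Ob (Src (nsrc \<alpha>)). comps \<beta> A \<cdot>\<^bsub>Tgt (nsrc \<alpha>)\<^esub> comps \<alpha> A)\<rparr>"

definition hcomp_nat ::
  "('o2, 'a2, 'o3, 'a3) nattrans \<Rightarrow> ('o1, 'a1, 'o2, 'a2) nattrans \<Rightarrow> ('o1, 'a1, 'o3, 'a3) nattrans"
  where
  "hcomp_nat \<beta> \<alpha> = \<lparr>nsrc = nsrc \<beta> \<circ>\<^sub>F nsrc \<alpha>, ntgt = ntgt \<beta> \<circ>\<^sub>F ntgt \<alpha>,
     comps = (\<lambda>A \<in> Ob (Src (nsrc \<alpha>)).
       comps \<beta> (omap (ntgt \<alpha>) A) \<cdot>\<^bsub>Tgt (nsrc \<beta>)\<^esub> amap (nsrc \<beta>) (comps \<alpha> A))\<rparr>"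


section \<open>Strict 2-categories and pseudo-functors\<close>

text \<open>
  \<open>cells1\<close> consists of the objects and 1-cells; \<open>cells2\<close> has the 1-cells as objects, the
  2-cells as arrows and vertical composition as composition; \<open>hcmp\<close> is horizontal
  composition of 2-cells.
\<close>

record ('o, 'm, 'c) two_cat =
  cells1 :: "('o, 'm) cat"
  cells2 :: "('m, 'c) cat"
  hcmp :: "'c \<Rightarrow> 'c \<Rightarrow> 'c" (infixr "\<star>\<index>" 70)

definition horizontal_cat :: "('o, 'm, 'c) two_cat \<Rightarrow> ('o, 'c) cat" where
  "horizontal_cat K =
    \<lparr>Ob = Ob (cells1 K),
     Ar = Ar (cells2 K),
     src = (\<lambda>\<alpha>. src (cells1 K) (src (cells2 K) \<alpha>)),
     tgt = (\<lambda>\<alpha>. tgt (cells1 K) (src (cells2 K) \<alpha>)),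
     ide = (\<lambda>A. ide (cells2 K) (ide (cells1 K) A)),
     cmp = hcmp K\<rparr>"

locale two_category =
  cells1: category "cells1 K" + cells2: category "cells2 K" + horizontal: category "horizontal_cat K"
  for K :: "('o, 'm, 'c) two_cat" (structure) +
  assumes Ob_cells2: "Ob (cells2 K) = Ar (cells1 K)"
    and parallel_src: "\<alpha> \<in> Ar (cells2 K) \<Longrightarrow>
      src (cells1 K) (src (cells2 K) \<alpha>) = src (cells1 K) (tgt (cells2 K) \<alpha>)"
    and parallel_tgt: "\<alpha> \<in> Ar (cells2 K) \<Longrightarrow>
      tgt (cells1 K) (src (cells2 K) \<alpha>) = tgt (cells1 K) (tgt (cells2 K) \<alpha>)"
    and src_hcmp: "\<lbrakk>\<alpha> \<in> Ar (cells2 K); \<beta> \<in> Ar (cells2 K);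
        tgt (cells1 K) (src (cells2 K) \<alpha>) = src (cells1 K) (src (cells2 K) \<beta>)\<rbrakk> \<Longrightarrow>
      src (cells2 K) (\<beta> \<star> \<alpha>) = src (cells2 K) \<beta> \<cdot>\<^bsub>cells1 K\<^esub> src (cells2 K) \<alpha>"
    and tgt_hcmp: "\<lbrakk>\<alpha> \<in> Ar (cells2 K); \<beta> \<in> Ar (cells2 K);
        tgt (cells1 K) (src (cells2 K) \<alpha>) = src (cells1 K) (src (cells2 K) \<beta>)\<rbrakk> \<Longrightarrow>
      tgt (cells2 K) (\<beta> \<star> \<alpha>) = tgt (cells2 K) \<beta> \<cdot>\<^bsub>cells1 K\<^esub> tgt (cells2 K) \<alpha>"
    and hcmp_ide: "\<lbrakk>f \<in> Ar (cells1 K); g \<in> Ar (cells1 K); tgt (cells1 K) f = src (cells1 K) g\<rbrakk> \<Longrightarrow>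
      ide (cells2 K) g \<star> ide (cells2 K) f = ide (cells2 K) (g \<cdot>\<^bsub>cells1 K\<^esub> f)"
    and interchange: "\<lbrakk>\<alpha> \<in> Ar (cells2 K); \<alpha>' \<in> Ar (cells2 K); \<beta> \<in> Ar (cells2 K); \<beta>' \<in> Ar (cells2 K);
        tgt (cells2 K) \<alpha> = src (cells2 K) \<alpha>'; tgt (cells2 K) \<beta> = src (cells2 K) \<beta>';
        tgt (cells1 K) (src (cells2 K) \<alpha>) = src (cells1 K) (src (cells2 K) \<beta>)\<rbrakk> \<Longrightarrow>
      (\<beta>' \<cdot>\<^bsub>cells2 K\<^esub> \<beta>) \<star> (\<alpha>' \<cdot>\<^bsub>cells2 K\<^esub> \<alpha>) = (\<beta>' \<star> \<alpha>') \<cdot>\<^bsub>cells2 K\<^esub> (\<beta> \<star> \<alpha>)"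

text \<open>
  A category regarded as a 2-category with only identity 2-cells: the 2-cell \<open>f\<close> is the
  identity of the 1-cell \<open>f\<close>.
\<close>

definition locally_discrete :: "('o, 'a) cat \<Rightarrow> ('o, 'a, 'a) two_cat" where
  "locally_discrete C =
    \<lparr>cells1 = C,
     cells2 = \<lparr>Ob = Ar C, Ar = Ar C, src = (\<lambda>f. f), tgt = (\<lambda>f. f), ide = (\<lambda>f. f), cmp = (\<lambda>g f. f)\<rparr>,
     hcmp = cmp C\<rparr>"

record ('o1, 'm1, 'c1, 'o2, 'm2, 'c2) pseudo_fnctr =
  on_ob :: "'o1 \<Rightarrow> 'o2"
  on_1 :: "'m1 \<Rightarrow> 'm2"
  on_2 :: "'c1 \<Rightarrow> 'c2"
  mult :: "'m1 \<Rightarrow> 'm1 \<Rightarrow> 'c2"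
  unit :: "'o1 \<Rightarrow> 'c2"

locale pseudo_functor = K: two_category K + L: two_category L
  for K :: "('o1, 'm1, 'c1) two_cat" and L :: "('o2, 'm2, 'c2) two_cat"
    and F :: "('o1, 'm1, 'c1, 'o2, 'm2, 'c2) pseudo_fnctr" +
  assumes on_ob_in: "A \<in> Ob (cells1 K) \<Longrightarrow> on_ob F A \<in> Ob (cells1 L)"
    and on_1_in: "f \<in> Ar (cells1 K) \<Longrightarrow> on_1 F f \<in> Ar (cells1 L)"
    and src_on_1: "f \<in> Ar (cells1 K) \<Longrightarrow> src (cells1 L) (on_1 F f) = on_ob F (src (cells1 K) f)"
    and tgt_on_1: "f \<in> Ar (cells1 K) \<Longrightarrow> tgt (cells1 L) (on_1 F f) = on_ob F (tgt (cells1 K) f)"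
    and on_2_in: "\<alpha> \<in> Ar (cells2 K) \<Longrightarrow> on_2 F \<alpha> \<in> Ar (cells2 L)"
    and src_on_2: "\<alpha> \<in> Ar (cells2 K) \<Longrightarrow> src (cells2 L) (on_2 F \<alpha>) = on_1 F (src (cells2 K) \<alpha>)"
    and tgt_on_2: "\<alpha> \<in> Ar (cells2 K) \<Longrightarrow> tgt (cells2 L) (on_2 F \<alpha>) = on_1 F (tgt (cells2 K) \<alpha>)"
    and on_2_ide: "f \<in> Ar (cells1 K) \<Longrightarrow> on_2 F (ide (cells2 K) f) = ide (cells2 L) (on_1 F f)"
    and on_2_cmp: "\<lbrakk>\<alpha> \<in> Ar (cells2 K); \<beta> \<in> Ar (cells2 K); tgt (cells2 K) \<alpha> = src (cells2 K) \<beta>\<rbrakk> \<Longrightarrow>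
      on_2 F (\<beta> \<cdot>\<^bsub>cells2 K\<^esub> \<alpha>) = on_2 F \<beta> \<cdot>\<^bsub>cells2 L\<^esub> on_2 F \<alpha>"
    and mult_iso: "\<lbrakk>f \<in> Ar (cells1 K); g \<in> Ar (cells1 K); tgt (cells1 K) f = src (cells1 K) g\<rbrakk> \<Longrightarrow>
      iso_arrow (cells2 L) (mult F g f)"
    and src_mult: "\<lbrakk>f \<in> Ar (cells1 K); g \<in> Ar (cells1 K); tgt (cells1 K) f = src (cells1 K) g\<rbrakk> \<Longrightarrow>
      src (cells2 L) (mult F g f) = on_1 F g \<cdot>\<^bsub>cells1 L\<^esub> on_1 F f"
    and tgt_mult: "\<lbrakk>f \<in> Ar (cells1 K); g \<in> Ar (cells1 K); tgt (cells1 K) f = src (cells1 K) g\<rbrakk> \<Longrightarrow>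
      tgt (cells2 L) (mult F g f) = on_1 F (g \<cdot>\<^bsub>cells1 K\<^esub> f)"
    and unit_iso: "A \<in> Ob (cells1 K) \<Longrightarrow> iso_arrow (cells2 L) (unit F A)"
    and src_unit: "A \<in> Ob (cells1 K) \<Longrightarrow>
      src (cells2 L) (unit F A) = ide (cells1 L) (on_ob F A)"
    and tgt_unit: "A \<in> Ob (cells1 K) \<Longrightarrow>
      tgt (cells2 L) (unit F A) = on_1 F (ide (cells1 K) A)"
    and mult_natural: "\<lbrakk>\<alpha> \<in> Ar (cells2 K); \<beta> \<in> Ar (cells2 K);
        tgt (cells1 K) (src (cells2 K) \<alpha>) = src (cells1 K) (src (cells2 K) \<beta>)\<rbrakk> \<Longrightarrow>
      on_2 F (\<beta> \<star>\<^bsub>K\<^esub> \<alpha>) \<cdot>\<^bsub>cells2 L\<^esub> mult F (src (cells2 K) \<beta>) (src (cells2 K) \<alpha>) =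
      mult F (tgt (cells2 K) \<beta>) (tgt (cells2 K) \<alpha>) \<cdot>\<^bsub>cells2 L\<^esub> (on_2 F \<beta> \<star>\<^bsub>L\<^esub> on_2 F \<alpha>)"
    and mult_assoc: "\<lbrakk>f \<in> Ar (cells1 K); g \<in> Ar (cells1 K); h \<in> Ar (cells1 K);
        tgt (cells1 K) f = src (cells1 K) g; tgt (cells1 K) g = src (cells1 K) h\<rbrakk> \<Longrightarrow>
      mult F h (g \<cdot>\<^bsub>cells1 K\<^esub> f) \<cdot>\<^bsub>cells2 L\<^esub> (ide (cells2 L) (on_1 F h) \<star>\<^bsub>L\<^esub> mult F g f) =
      mult F (h \<cdot>\<^bsub>cells1 K\<^esub> g) f \<cdot>\<^bsub>cells2 L\<^esub> (mult F h g \<star>\<^bsub>L\<^esub> ide (cells2 L) (on_1 F f))"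
    and unit_right: "f \<in> Ar (cells1 K) \<Longrightarrow>
      mult F f (ide (cells1 K) (src (cells1 K) f)) \<cdot>\<^bsub>cells2 L\<^esub>
        (ide (cells2 L) (on_1 F f) \<star>\<^bsub>L\<^esub> unit F (src (cells1 K) f)) = ide (cells2 L) (on_1 F f)"
    and unit_left: "f \<in> Ar (cells1 K) \<Longrightarrow>
      mult F (ide (cells1 K) (tgt (cells1 K) f)) f \<cdot>\<^bsub>cells2 L\<^esub>
        (unit F (tgt (cells1 K) f) \<star>\<^bsub>L\<^esub> ide (cells2 L) (on_1 F f)) = ide (cells2 L) (on_1 F f)"


section \<open>Fibrations and cleavages\<close>

definition cartesian :: "('eo, 'ea, 'bo, 'ba) fnctr \<Rightarrow> 'ea \<Rightarrow> bool" where
  "cartesian P \<phi> \<longleftrightarrow> \<phi> \<in> Ar (Src P) \<and>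
     (\<forall>\<psi> \<in> Ar (Src P). \<forall>h \<in> Ar (Tgt P).
        tgt (Src P) \<psi> = tgt (Src P) \<phi> \<longrightarrow>
        src (Tgt P) h = omap P (src (Src P) \<psi>) \<longrightarrow>
        tgt (Tgt P) h = omap P (src (Src P) \<phi>) \<longrightarrow>
        amap P \<psi> = amap P \<phi> \<cdot>\<^bsub>Tgt P\<^esub> h \<longrightarrow>
        (\<exists>!\<chi>. \<chi> \<in> Ar (Src P) \<and> src (Src P) \<chi> = src (Src P) \<psi> \<and> tgt (Src P) \<chi> = src (Src P) \<phi> \<and>
           amap P \<chi> = h \<and> \<phi> \<cdot>\<^bsub>Src P\<^esub> \<chi> = \<psi>))"

definition cartesian_lift :: "('eo, 'ea, 'bo, 'ba) fnctr \<Rightarrow> 'ba \<Rightarrow> 'eo \<Rightarrow> 'ea \<Rightarrow> bool" where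
  "cartesian_lift P f E \<phi> \<longleftrightarrow> cartesian P \<phi> \<and> tgt (Src P) \<phi> = E \<and> amap P \<phi> = f"

locale fibration = is_functor P for P :: "('eo, 'ea, 'bo, 'ba) fnctr" +
  assumes ex_cartesian_lift:
    "\<lbrakk>f \<in> Ar (Tgt P); E \<in> Ob (Src P); omap P E = tgt (Tgt P) f\<rbrakk> \<Longrightarrow> \<exists>\<phi>. cartesian_lift P f E \<phi>"

definition cleavage :: "('eo, 'ea, 'bo, 'ba) fnctr \<Rightarrow> ('ba \<Rightarrow> 'eo \<Rightarrow> 'ea) \<Rightarrow> bool" where
  "cleavage P \<kappa> \<longleftrightarrow> (\<forall>f \<in> Ar (Tgt P). \<forall>E \<in> Ob (Src P).
     omap P E = tgt (Tgt P) f \<longrightarrow> cartesian_lift P f E (\<kappa> f E))"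

definition composite_cleavage ::
  "('eo, 'ea, 'do, 'da) fnctr \<Rightarrow> ('ba \<Rightarrow> 'do \<Rightarrow> 'da) \<Rightarrow> ('da \<Rightarrow> 'eo \<Rightarrow> 'ea) \<Rightarrow> 'ba \<Rightarrow> 'eo \<Rightarrow> 'ea"
  where
  "composite_cleavage Q \<kappa>P \<kappa>Q f E = \<kappa>Q (\<kappa>P f (omap Q E)) E"

definition fibre :: "('eo, 'ea, 'bo, 'ba) fnctr \<Rightarrow> 'bo \<Rightarrow> ('eo, 'ea) cat" where
  "fibre P A = (Src P)
    \<lparr>Ob := {E \<in> Ob (Src P). omap P E = A},
     Ar := {e \<in> Ar (Src P). amap P e = ide (Tgt P) A}\<rparr>"

text \<open>The factorization of \<open>\<psi>\<close> through \<open>\<phi>\<close> over \<open>h\<close>; it exists uniquely if \<open>\<phi>\<close> is Cartesian.\<close>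

definition factor :: "('eo, 'ea, 'bo, 'ba) fnctr \<Rightarrow> 'ea \<Rightarrow> 'ba \<Rightarrow> 'ea \<Rightarrow> 'ea" where
  "factor P \<phi> h \<psi> = (THE \<chi>. \<chi> \<in> Ar (Src P) \<and>
     src (Src P) \<chi> = src (Src P) \<psi> \<and> tgt (Src P) \<chi> = src (Src P) \<phi> \<and>
     amap P \<chi> = h \<and> \<phi> \<cdot>\<^bsub>Src P\<^esub> \<chi> = \<psi>)"

definition inverse_image ::
  "('eo, 'ea, 'bo, 'ba) fnctr \<Rightarrow> ('ba \<Rightarrow> 'eo \<Rightarrow> 'ea) \<Rightarrow> 'ba \<Rightarrow> ('eo, 'ea, 'eo, 'ea) fnctr" where
  "inverse_image P \<kappa> f =
    \<lparr>Src = fibre P (tgt (Tgt P) f),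
     Tgt = fibre P (src (Tgt P) f),
     omap = (\<lambda>E \<in> Ob (fibre P (tgt (Tgt P) f)). src (Src P) (\<kappa> f E)),
     amap = (\<lambda>e \<in> Ar (fibre P (tgt (Tgt P) f)).
       factor P (\<kappa> f (tgt (Src P) e)) (ide (Tgt P) (src (Tgt P) f))
         (e \<cdot>\<^bsub>Src P\<^esub> \<kappa> f (src (Src P) e)))\<rparr>"

text \<open>
  For \<open>f : A \<rightarrow> B\<close> and \<open>g : B \<rightarrow> C\<close> in the base, the canonical transformation
  \<open>f\<^sup>* g\<^sup>* \<Rightarrow> (g f)\<^sup>*\<close>, and for an object \<open>A\<close> the canonical transformation \<open>Id \<Rightarrow> 1\<^sub>A\<^sup>*\<close>.
\<close>

definition inverse_image_mult ::
  "('eo, 'ea, 'bo, 'ba) fnctr \<Rightarrow> ('ba \<Rightarrow> 'eo \<Rightarrow> 'ea) \<Rightarrow> 'ba \<Rightarrow> 'ba \<Rightarrow> ('eo, 'ea, 'eo, 'ea) nattrans" where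
  "inverse_image_mult P \<kappa> f g =
    \<lparr>nsrc = inverse_image P \<kappa> f \<circ>\<^sub>F inverse_image P \<kappa> g,
     ntgt = inverse_image P \<kappa> (g \<cdot>\<^bsub>Tgt P\<^esub> f),
     comps = (\<lambda>E \<in> Ob (fibre P (tgt (Tgt P) g)).
       factor P (\<kappa> (g \<cdot>\<^bsub>Tgt P\<^esub> f) E) (ide (Tgt P) (src (Tgt P) f))
         (\<kappa> g E \<cdot>\<^bsub>Src P\<^esub> \<kappa> f (src (Src P) (\<kappa> g E))))\<rparr>"

definition inverse_image_unit ::
  "('eo, 'ea, 'bo, 'ba) fnctr \<Rightarrow> ('ba \<Rightarrow> 'eo \<Rightarrow> 'ea) \<Rightarrow> 'bo \<Rightarrow> ('eo, 'ea, 'eo, 'ea) nattrans" where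
  "inverse_image_unit P \<kappa> A =
    \<lparr>nsrc = id_fnctr (fibre P A),
     ntgt = inverse_image P \<kappa> (ide (Tgt P) A),
     comps = (\<lambda>E \<in> Ob (fibre P A).
       factor P (\<kappa> (ide (Tgt P) A) E) (ide (Tgt P) A) (ide (Src P) E))\<rparr>"


section \<open>The 2-category of fibrations and Cartesian morphisms\<close>

record ('eo, 'ea, 'bo, 'ba) fib_mor =
  msrc :: "('eo, 'ea, 'bo, 'ba) fnctr"
  mtgt :: "('eo, 'ea, 'bo, 'ba) fnctr"
  total :: "('eo, 'ea, 'eo, 'ea) fnctr"
  base :: "('bo, 'ba, 'bo, 'ba) fnctr"

locale cartesian_morphism =
  source: fibration "msrc H" + target: fibration "mtgt H" +
  total: is_functor "total H" + base: is_functor "base H"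
  for H :: "('eo, 'ea, 'bo, 'ba) fib_mor" +
  assumes Src_total: "Src (total H) = Src (msrc H)"
    and Tgt_total: "Tgt (total H) = Src (mtgt H)"
    and Src_base: "Src (base H) = Tgt (msrc H)"
    and Tgt_base: "Tgt (base H) = Tgt (mtgt H)"
    and square: "mtgt H \<circ>\<^sub>F total H = base H \<circ>\<^sub>F msrc H"
    and preserves_cartesian: "cartesian (msrc H) \<phi> \<Longrightarrow> cartesian (mtgt H) (amap (total H) \<phi>)"

record ('eo, 'ea, 'bo, 'ba) fib_cell =
  csrc :: "('eo, 'ea, 'bo, 'ba) fib_mor"
  ctgt :: "('eo, 'ea, 'bo, 'ba) fib_mor"
  ctotal :: "('eo, 'ea, 'eo, 'ea) nattrans"
  cbase :: "('bo, 'ba, 'bo, 'ba) nattrans"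

locale fibred_cell =
  source: cartesian_morphism "csrc \<alpha>" + target: cartesian_morphism "ctgt \<alpha>" +
  total: natural_transformation "ctotal \<alpha>" + base: natural_transformation "cbase \<alpha>"
  for \<alpha> :: "('eo, 'ea, 'bo, 'ba) fib_cell" +
  assumes same_msrc: "msrc (csrc \<alpha>) = msrc (ctgt \<alpha>)"
    and same_mtgt: "mtgt (csrc \<alpha>) = mtgt (ctgt \<alpha>)"
    and nsrc_total: "nsrc (ctotal \<alpha>) = total (csrc \<alpha>)"
    and ntgt_total: "ntgt (ctotal \<alpha>) = total (ctgt \<alpha>)"
    and nsrc_base: "nsrc (cbase \<alpha>) = base (csrc \<alpha>)"
    and ntgt_base: "ntgt (cbase \<alpha>) = base (ctgt \<alpha>)"
    and lies_over: "E \<in> Ob (Src (msrc (csrc \<alpha>))) \<Longrightarrow>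
      amap (mtgt (csrc \<alpha>)) (comps (ctotal \<alpha>) E) = comps (cbase \<alpha>) (omap (msrc (csrc \<alpha>)) E)"

definition id_fib_mor :: "('eo, 'ea, 'bo, 'ba) fnctr \<Rightarrow> ('eo, 'ea, 'bo, 'ba) fib_mor" where
  "id_fib_mor Q = \<lparr>msrc = Q, mtgt = Q, total = id_fnctr (Src Q), base = id_fnctr (Tgt Q)\<rparr>"

definition comp_fib_mor ::
  "('eo, 'ea, 'bo, 'ba) fib_mor \<Rightarrow> ('eo, 'ea, 'bo, 'ba) fib_mor \<Rightarrow> ('eo, 'ea, 'bo, 'ba) fib_mor" where
  "comp_fib_mor K H =
    \<lparr>msrc = msrc H, mtgt = mtgt K, total = total K \<circ>\<^sub>F total H, base = base K \<circ>\<^sub>F base H\<rparr>"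

definition id_fib_cell :: "('eo, 'ea, 'bo, 'ba) fib_mor \<Rightarrow> ('eo, 'ea, 'bo, 'ba) fib_cell" where
  "id_fib_cell H =
    \<lparr>csrc = H, ctgt = H, ctotal = id_nat (total H), cbase = id_nat (base H)\<rparr>"

definition vcomp_fib_cell ::
  "('eo, 'ea, 'bo, 'ba) fib_cell \<Rightarrow> ('eo, 'ea, 'bo, 'ba) fib_cell \<Rightarrow> ('eo, 'ea, 'bo, 'ba) fib_cell" where
  "vcomp_fib_cell \<beta> \<alpha> =
    \<lparr>csrc = csrc \<alpha>, ctgt = ctgt \<beta>,
     ctotal = vcomp_nat (ctotal \<beta>) (ctotal \<alpha>), cbase = vcomp_nat (cbase \<beta>) (cbase \<alpha>)\<rparr>"

definition hcomp_fib_cell ::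
  "('eo, 'ea, 'bo, 'ba) fib_cell \<Rightarrow> ('eo, 'ea, 'bo, 'ba) fib_cell \<Rightarrow> ('eo, 'ea, 'bo, 'ba) fib_cell" where
  "hcomp_fib_cell \<beta> \<alpha> =
    \<lparr>csrc = comp_fib_mor (csrc \<beta>) (csrc \<alpha>), ctgt = comp_fib_mor (ctgt \<beta>) (ctgt \<alpha>),
     ctotal = hcomp_nat (ctotal \<beta>) (ctotal \<alpha>), cbase = hcomp_nat (cbase \<beta>) (cbase \<alpha>)\<rparr>"

text \<open>
  The four type parameters play the role of the universes in which the objects and arrows of
  the total and of the base categories live.
\<close>

definition FIBc ::
  "(('eo, 'ea, 'bo, 'ba) fnctr, ('eo, 'ea, 'bo, 'ba) fib_mor, ('eo, 'ea, 'bo, 'ba) fib_cell) two_cat"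
  where
  "FIBc =
    \<lparr>cells1 = \<lparr>Ob = {Q. fibration Q}, Ar = {H. cartesian_morphism H},
       src = msrc, tgt = mtgt, ide = id_fib_mor, cmp = comp_fib_mor\<rparr>,
     cells2 = \<lparr>Ob = {H. cartesian_morphism H}, Ar = {\<alpha>. fibred_cell \<alpha>},
       src = csrc, tgt = ctgt, ide = id_fib_cell, cmp = vcomp_fib_cell\<rparr>,
     hcmp = hcomp_fib_cell\<rparr>"


section \<open>The correspondence \<open>\<Xi>\<^sub>Q\<close>\<close>

definition fibre_restriction ::
  "('do, 'da, 'bo, 'ba) fnctr \<Rightarrow> ('eo, 'ea, 'do, 'da) fnctr \<Rightarrow> 'bo \<Rightarrow> ('eo, 'ea, 'do, 'da) fnctr" where
  "fibre_restriction P Q A =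
    \<lparr>Src = fibre (P \<circ>\<^sub>F Q) A,
     Tgt = fibre P A,
     omap = restrict (omap Q) (Ob (fibre (P \<circ>\<^sub>F Q) A)),
     amap = restrict (amap Q) (Ar (fibre (P \<circ>\<^sub>F Q) A))\<rparr>"

definition inverse_image_square ::
  "('do, 'da, 'bo, 'ba) fnctr \<Rightarrow> ('ba \<Rightarrow> 'do \<Rightarrow> 'da) \<Rightarrow>
   ('eo, 'ea, 'do, 'da) fnctr \<Rightarrow> ('da \<Rightarrow> 'eo \<Rightarrow> 'ea) \<Rightarrow> 'ba \<Rightarrow> ('eo, 'ea, 'do, 'da) fib_mor" where
  "inverse_image_square P \<kappa>P Q \<kappa>Q f =
    \<lparr>msrc = fibre_restriction P Q (tgt (Tgt P) f),
     mtgt = fibre_restriction P Q (src (Tgt P) f),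
     total = inverse_image (P \<circ>\<^sub>F Q) (composite_cleavage Q \<kappa>P \<kappa>Q) f,
     base = inverse_image P \<kappa>P f\<rparr>"

text \<open>
  In the opposite of the base, \<open>f : B \<rightarrow> A\<close> after \<open>g : C \<rightarrow> B\<close> is the composite \<open>g f\<close> of the
  base, so that \<open>mult\<close> at \<open>f\<close> and \<open>g\<close> is a 2-cell from \<open>f\<^sup>* g\<^sup>*\<close> to \<open>(g f)\<^sup>*\<close>.
\<close>

definition Xi ::
  "('do, 'da, 'bo, 'ba) fnctr \<Rightarrow> ('ba \<Rightarrow> 'do \<Rightarrow> 'da) \<Rightarrow>
   ('eo, 'ea, 'do, 'da) fnctr \<Rightarrow> ('da \<Rightarrow> 'eo \<Rightarrow> 'ea) \<Rightarrow>
   ('bo, 'ba, 'ba, ('eo, 'ea, 'do, 'da) fnctr, ('eo, 'ea, 'do, 'da) fib_mor,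
     ('eo, 'ea, 'do, 'da) fib_cell) pseudo_fnctr" where
  "Xi P \<kappa>P Q \<kappa>Q =
    \<lparr>on_ob = fibre_restriction P Q,
     on_1 = inverse_image_square P \<kappa>P Q \<kappa>Q,
     on_2 = (\<lambda>f. id_fib_cell (inverse_image_square P \<kappa>P Q \<kappa>Q f)),
     mult = (\<lambda>f g.
       \<lparr>csrc = comp_fib_mor (inverse_image_square P \<kappa>P Q \<kappa>Q f) (inverse_image_square P \<kappa>P Q \<kappa>Q g),
        ctgt = inverse_image_square P \<kappa>P Q \<kappa>Q (g \<cdot>\<^bsub>Tgt P\<^esub> f),
        ctotal = inverse_image_mult (P \<circ>\<^sub>F Q) (composite_cleavage Q \<kappa>P \<kappa>Q) f g,
        cbase = inverse_image_mult P \<kappa>P f g\<rparr>),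
     unit = (\<lambda>A.
       \<lparr>csrc = id_fib_mor (fibre_restriction P Q A),
        ctgt = inverse_image_square P \<kappa>P Q \<kappa>Q (ide (Tgt P) A),
        ctotal = inverse_image_unit (P \<circ>\<^sub>F Q) (composite_cleavage Q \<kappa>P \<kappa>Q) A,
        cbase = inverse_image_unit P \<kappa>P A\<rparr>)\<rparr>"

end

theory Submission
  imports Defs
begin

text \<open>
  The proof replaces inverse image functors by a notion that is closed under composition. Call a
  functor \<open>F\<close> from the fibre over \<open>B\<close> to the fibre over \<open>A\<close>, with a natural family of Cartesian arrows
  \<open>l E: F E \<rightarrow> E\<close> over \<open>f: A \<rightarrow> B\<close>, a reindexing along \<open>f\<close> (locale \<open>reindexing\<close>). Since the lifts are
  Cartesian, between two reindexings along the same arrow there is exactly one transformation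
  of functors into the fibre over \<open>A\<close> that is compatible with the lifts, the \<open>comparison\<close>; it is
  invertible. Vertical and horizontal composites of comparisons are comparisons, and so are
  identities (\<open>vcomp_comparison\<close>, \<open>hcomp_comparison\<close>, \<open>comparison_self\<close>).

  For any cleavage, \<open>f\<^sup>*\<close>, \<open>f\<^sup>* g\<^sup>*\<close> and the identity functor are reindexings along \<open>f\<close>, \<open>g f\<close> and an
  identity, and the structure isomorphisms are the comparisons between them. The two sides of
  each coherence equation are therefore comparisons between the same two reindexings, and
  agree. This is applied to \<open>P\<close> and to \<open>P \<circ>\<^sub>F Q\<close>, for which the composite cleavage is a cleavage
  because a \<open>Q\<close>-Cartesian arrow over a \<open>P\<close>-Cartesian one is Cartesian for the composite
  (\<open>cartesian_composite\<close>).

  The functor \<open>Q\<close> carries the lifts of the composite cleavage to the lifts of \<open>P\<close>. By uniqueness it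
  carries inverse images to inverse images and comparisons to comparisons, so that the squares
  commute strictly and the structure isomorphisms are cells between them (\<open>fibred_cell_comparison\<close>).

  It remains to see that the restrictions of \<open>Q\<close> are fibrations and that the squares preserve
  Cartesian arrows. An arrow of a fibre of \<open>P \<circ>\<^sub>F Q\<close> is Cartesian for the restriction of \<open>Q\<close> if and only
  if it is \<open>Q\<close>-Cartesian (\<open>cartesian_restrI\<close>, \<open>cartesian_restrD\<close>). In the square
  \<open>l E' \<cdot> f\<^sup>* \<phi> = \<phi> \<cdot> l E\<close> the lifts are \<open>Q\<close>-Cartesian by the choice of the composite cleavage, hence
  \<open>f\<^sup>* \<phi>\<close> is \<open>Q\<close>-Cartesian if \<open>\<phi>\<close> is (\<open>preserves_cartesian\<close>).
\<close>

section \<open>Functors and natural transformations\<close>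

lemma fcomp_simps [simp]:
  "Src (G \<circ>\<^sub>F F) = Src F" "Tgt (G \<circ>\<^sub>F F) = Tgt G"
  "A \<in> Ob (Src F) \<Longrightarrow> omap (G \<circ>\<^sub>F F) A = omap G (omap F A)"
  "f \<in> Ar (Src F) \<Longrightarrow> amap (G \<circ>\<^sub>F F) f = amap G (amap F f)"
  by (simp_all add: fcomp_def compose_eq)

lemma id_fnctr_simps [simp]:
  "Src (id_fnctr C) = C" "Tgt (id_fnctr C) = C"
  "A \<in> Ob C \<Longrightarrow> omap (id_fnctr C) A = A"
  "f \<in> Ar C \<Longrightarrow> amap (id_fnctr C) f = f"
  by (simp_all add: id_fnctr_def)

lemma fnctr_eqI:
  assumes "is_functor F" "is_functor G" "Src F = Src G" "Tgt F = Tgt G"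
    and "\<And>A. A \<in> Ob (Src F) \<Longrightarrow> omap F A = omap G A"
    and "\<And>f. f \<in> Ar (Src F) \<Longrightarrow> amap F f = amap G f"
  shows "F = G"
proof -
  interpret F: is_functor F by fact
  interpret G: is_functor G by fact
  have "omap F = omap G" "amap F = amap G"
    using F.omap_ext G.omap_ext F.amap_ext G.amap_ext assms(3-) by (metis extensionalityI)+
  with assms(3,4) show ?thesis by simp
qed

lemma is_functor_id: "category C \<Longrightarrow> is_functor (id_fnctr C)"
proof -
  assume "category C"
  then interpret category C .
  show ?thesis
    by unfold_locales
      (auto simp: src_in tgt_in ide_in cmp_in src_ide tgt_ide src_cmp tgt_cmp cmp_ide_right
        cmp_ide_left cmp_assoc id_fnctr_def)
qed

lemma is_functor_fcomp:
  assumes "is_functor F" "is_functor G" "Tgt F = Src G"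
  shows "is_functor (G \<circ>\<^sub>F F)"
proof -
  interpret F: is_functor F by fact
  interpret G: is_functor G by fact
  note [simp] = F.omap_in F.amap_in F.src_amap F.tgt_amap F.amap_ide F.amap_cmp assms(3)
    G.omap_in G.amap_in G.src_amap G.tgt_amap G.amap_ide G.amap_cmp
    F.S.src_in F.S.tgt_in F.S.ide_in F.S.cmp_in
    F.omap_in [unfolded assms(3)] F.amap_in [unfolded assms(3)] F.src_amap [unfolded assms(3)]
    F.tgt_amap [unfolded assms(3)] F.amap_ide [unfolded assms(3)] F.amap_cmp [unfolded assms(3)]
  show ?thesis
    by (intro is_functor.intro is_functor_axioms.intro)
      (auto simp: F.S.category_axioms G.T.category_axioms fcomp_def compose_eq)
qed

lemma fcomp_assoc:
  assumes "is_functor F" "is_functor G" "is_functor H" "Tgt F = Src G" "Tgt G = Src H"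
  shows "(H \<circ>\<^sub>F G) \<circ>\<^sub>F F = H \<circ>\<^sub>F (G \<circ>\<^sub>F F)"
proof -
  interpret F: is_functor F by fact
  show ?thesis
    using assms F.omap_in F.amap_in by (intro fnctr_eqI is_functor_fcomp) auto
qed

lemma fcomp_id:
  assumes "is_functor F"
  shows "F \<circ>\<^sub>F id_fnctr (Src F) = F" "id_fnctr (Tgt F) \<circ>\<^sub>F F = F"
proof -
  interpret F: is_functor F by fact
  show "F \<circ>\<^sub>F id_fnctr (Src F) = F" "id_fnctr (Tgt F) \<circ>\<^sub>F F = F"
    using F.omap_in F.amap_in
    by (auto intro!: fnctr_eqI is_functor_fcomp is_functor_id F.is_functor_axioms
        F.S.category_axioms F.T.category_axioms)
qed

lemma id_nat_simps [simp]:
  "nsrc (id_nat F) = F" "ntgt (id_nat F) = F"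
  "A \<in> Ob (Src F) \<Longrightarrow> comps (id_nat F) A = ide (Tgt F) (omap F A)"
  by (simp_all add: id_nat_def)

lemma vcomp_nat_simps [simp]:
  "nsrc (vcomp_nat \<beta> \<alpha>) = nsrc \<alpha>" "ntgt (vcomp_nat \<beta> \<alpha>) = ntgt \<beta>"
  "A \<in> Ob (Src (nsrc \<alpha>)) \<Longrightarrow>
    comps (vcomp_nat \<beta> \<alpha>) A = comps \<beta> A \<cdot>\<^bsub>Tgt (nsrc \<alpha>)\<^esub> comps \<alpha> A"
  by (simp_all add: vcomp_nat_def)

lemma hcomp_nat_simps [simp]:
  "nsrc (hcomp_nat \<beta> \<alpha>) = nsrc \<beta> \<circ>\<^sub>F nsrc \<alpha>" "ntgt (hcomp_nat \<beta> \<alpha>) = ntgt \<beta> \<circ>\<^sub>F ntgt \<alpha>"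
  "A \<in> Ob (Src (nsrc \<alpha>)) \<Longrightarrow> comps (hcomp_nat \<beta> \<alpha>) A =
    comps \<beta> (omap (ntgt \<alpha>) A) \<cdot>\<^bsub>Tgt (nsrc \<beta>)\<^esub> amap (nsrc \<beta>) (comps \<alpha> A)"
  by (simp_all add: hcomp_nat_def)

text \<open>
  The axioms of functors and of natural transformations between functors \<open>C \<rightarrow> D\<close>, with the
  two categories as variables: in this form they are usable as rewrite rules.
\<close>

locale transformation = C: category C + D: category D + A: natural_transformation \<alpha>
  for C :: "('o1, 'a1) cat" and D :: "('o2, 'a2) cat" and \<alpha> +
  assumes Src_nsrc [simp]: "Src (nsrc \<alpha>) = C" and Tgt_nsrc [simp]: "Tgt (nsrc \<alpha>) = D"
begin

lemma Src_ntgt [simp]: "Src (ntgt \<alpha>) = C" and Tgt_ntgt [simp]: "Tgt (ntgt \<alpha>) = D"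
  using A.same_Src A.same_Tgt by simp_all

lemmas nsrc_rules [simp] = A.F.omap_in [unfolded Src_nsrc Tgt_nsrc]
  A.F.amap_in [unfolded Src_nsrc Tgt_nsrc] A.F.src_amap [unfolded Src_nsrc Tgt_nsrc]
  A.F.tgt_amap [unfolded Src_nsrc Tgt_nsrc] A.F.amap_ide [unfolded Src_nsrc Tgt_nsrc]
  A.F.amap_cmp [unfolded Src_nsrc Tgt_nsrc]

lemmas ntgt_rules [simp] = A.G.omap_in [unfolded Src_ntgt Tgt_ntgt]
  A.G.amap_in [unfolded Src_ntgt Tgt_ntgt] A.G.src_amap [unfolded Src_ntgt Tgt_ntgt]
  A.G.tgt_amap [unfolded Src_ntgt Tgt_ntgt] A.G.amap_ide [unfolded Src_ntgt Tgt_ntgt]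
  A.G.amap_cmp [unfolded Src_ntgt Tgt_ntgt]

lemmas comps_rules [simp] = A.comps_in [unfolded Src_nsrc Tgt_nsrc]
  A.src_comps [unfolded Src_nsrc Tgt_nsrc] A.tgt_comps [unfolded Src_nsrc Tgt_nsrc]

lemmas naturality = A.naturality [unfolded Src_nsrc Tgt_nsrc]

lemmas category_rules [simp] =
  C.src_in C.tgt_in C.ide_in C.src_ide C.tgt_ide C.cmp_in C.src_cmp C.tgt_cmp
  C.cmp_ide_right C.cmp_ide_left
  D.src_in D.tgt_in D.ide_in D.src_ide D.tgt_ide D.cmp_in D.src_cmp D.tgt_cmp
  D.cmp_ide_right D.cmp_ide_left

end

lemma transformationI:
  "\<lbrakk>natural_transformation \<alpha>; Src (nsrc \<alpha>) = C; Tgt (nsrc \<alpha>) = D\<rbrakk> \<Longrightarrow> transformation C D \<alpha>"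
  by (auto simp: transformation_def transformation_axioms_def natural_transformation_def is_functor_def)

lemma transformation_eqI:
  assumes "transformation C D \<alpha>" "transformation C D \<beta>" "nsrc \<alpha> = nsrc \<beta>" "ntgt \<alpha> = ntgt \<beta>"
    and "\<And>A. A \<in> Ob C \<Longrightarrow> comps \<alpha> A = comps \<beta> A"
  shows "\<alpha> = \<beta>"
proof -
  interpret a: transformation C D \<alpha> by fact
  interpret b: transformation C D \<beta> by fact
  have "comps \<alpha> = comps \<beta>"
    using a.A.comps_ext b.A.comps_ext assms(5) a.Src_nsrc b.Src_nsrc by (metis extensionalityI)
  with assms(3,4) show ?thesis by simp
qed

lemma transformation_id:
  assumes "is_functor F" "Src F = C" "Tgt F = D"
  shows "transformation C D (id_nat F)"
proof -
  interpret F: is_functor F by fact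
  note [simp] = F.omap_in F.amap_in F.src_amap F.tgt_amap F.S.src_in F.S.tgt_in
    F.T.ide_in F.T.src_ide F.T.tgt_ide
  have "f \<in> Ar (Src F) \<Longrightarrow> ide (Tgt F) (omap F (tgt (Src F) f)) \<cdot>\<^bsub>Tgt F\<^esub> amap F f =
         amap F f \<cdot>\<^bsub>Tgt F\<^esub> ide (Tgt F) (omap F (src (Src F) f))" for f
    using F.T.cmp_ide_left [of "amap F f"] F.T.cmp_ide_right [of "amap F f"] by simp
  then have "natural_transformation (id_nat F)"
    by (intro natural_transformation.intro natural_transformation_axioms.intro)
      (auto simp: F.is_functor_axioms id_nat_def)
  then show ?thesis
    using assms(2,3) by (intro transformationI) auto
qed

lemma transformation_vcomp:
  assumes "transformation C D \<alpha>" "transformation C D \<beta>" "ntgt \<alpha> = nsrc \<beta>"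
  shows "transformation C D (vcomp_nat \<beta> \<alpha>)"
proof -
  interpret a: transformation C D \<alpha> by fact
  interpret b: transformation C D \<beta> by fact
  note [simp] = assms(3) [symmetric]
  have "(comps \<beta> (tgt C f) \<cdot>\<^bsub>D\<^esub> comps \<alpha> (tgt C f)) \<cdot>\<^bsub>D\<^esub> amap (nsrc \<alpha>) f =
        amap (ntgt \<beta>) f \<cdot>\<^bsub>D\<^esub> (comps \<beta> (src C f) \<cdot>\<^bsub>D\<^esub> comps \<alpha> (src C f))"
    if f: "f \<in> Ar C" for f
  proof -
    have "(comps \<beta> (tgt C f) \<cdot>\<^bsub>D\<^esub> comps \<alpha> (tgt C f)) \<cdot>\<^bsub>D\<^esub> amap (nsrc \<alpha>) f =
          comps \<beta> (tgt C f) \<cdot>\<^bsub>D\<^esub> (amap (ntgt \<alpha>) f \<cdot>\<^bsub>D\<^esub> comps \<alpha> (src C f))"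
      using f by (subst a.D.cmp_assoc) (auto simp: a.naturality)
    also have "\<dots> = (amap (ntgt \<beta>) f \<cdot>\<^bsub>D\<^esub> comps \<beta> (src C f)) \<cdot>\<^bsub>D\<^esub> comps \<alpha> (src C f)"
      using f b.naturality [OF f] by (subst a.D.cmp_assoc [symmetric]) auto
    also have "\<dots> = amap (ntgt \<beta>) f \<cdot>\<^bsub>D\<^esub> (comps \<beta> (src C f) \<cdot>\<^bsub>D\<^esub> comps \<alpha> (src C f))"
      using f by (subst a.D.cmp_assoc) auto
    finally show ?thesis .
  qed
  then have "natural_transformation (vcomp_nat \<beta> \<alpha>)"
    by (intro natural_transformation.intro natural_transformation_axioms.intro)
      (auto simp: a.A.F.is_functor_axioms b.A.G.is_functor_axioms vcomp_nat_def)
  then show ?thesis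
    by (intro transformationI) auto
qed

lemma transformation_hcomp:
  assumes "transformation C D \<alpha>" "transformation D E \<beta>"
  shows "transformation C E (hcomp_nat \<beta> \<alpha>)"
proof -
  interpret a: transformation C D \<alpha> by fact
  interpret b: transformation D E \<beta> by fact
  have "(comps \<beta> (omap (ntgt \<alpha>) (tgt C f)) \<cdot>\<^bsub>E\<^esub> amap (nsrc \<beta>) (comps \<alpha> (tgt C f))) \<cdot>\<^bsub>E\<^esub>
          amap (nsrc \<beta>) (amap (nsrc \<alpha>) f) =
        amap (ntgt \<beta>) (amap (ntgt \<alpha>) f) \<cdot>\<^bsub>E\<^esub>
          (comps \<beta> (omap (ntgt \<alpha>) (src C f)) \<cdot>\<^bsub>E\<^esub> amap (nsrc \<beta>) (comps \<alpha> (src C f)))"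
    (is "(?bt \<cdot>\<^bsub>_\<^esub> ?at) \<cdot>\<^bsub>_\<^esub> ?f = ?f' \<cdot>\<^bsub>_\<^esub> (?bs \<cdot>\<^bsub>_\<^esub> ?as)")
    if f: "f \<in> Ar C" for f
  proof -
    have "(?bt \<cdot>\<^bsub>E\<^esub> ?at) \<cdot>\<^bsub>E\<^esub> ?f =
        ?bt \<cdot>\<^bsub>E\<^esub> amap (nsrc \<beta>) (comps \<alpha> (tgt C f) \<cdot>\<^bsub>D\<^esub> amap (nsrc \<alpha>) f)"
      using f by (subst b.D.cmp_assoc) auto
    also have "\<dots> = (?bt \<cdot>\<^bsub>E\<^esub> amap (nsrc \<beta>) (amap (ntgt \<alpha>) f)) \<cdot>\<^bsub>E\<^esub> ?as"
      unfolding a.naturality [OF f] using f by (subst b.D.cmp_assoc) auto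
    also have "\<dots> = (?f' \<cdot>\<^bsub>E\<^esub> ?bs) \<cdot>\<^bsub>E\<^esub> ?as"
      using b.naturality [of "amap (ntgt \<alpha>) f"] f by simp
    also have "\<dots> = ?f' \<cdot>\<^bsub>E\<^esub> (?bs \<cdot>\<^bsub>E\<^esub> ?as)"
      using f by (subst b.D.cmp_assoc) auto
    finally show ?thesis .
  qed
  then have "natural_transformation (hcomp_nat \<beta> \<alpha>)"
    by (intro natural_transformation.intro natural_transformation_axioms.intro)
      (auto simp: a.A.F.is_functor_axioms b.A.G.is_functor_axioms
        b.A.F.is_functor_axioms a.A.G.is_functor_axioms hcomp_nat_def intro!: is_functor_fcomp)
  then show ?thesis
    by (intro transformationI) auto
qed

lemma vcomp_nat_assoc:
  assumes "transformation C D \<alpha>" "transformation C D \<beta>" "transformation C D \<gamma>"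
    and "ntgt \<alpha> = nsrc \<beta>" "ntgt \<beta> = nsrc \<gamma>"
  shows "vcomp_nat (vcomp_nat \<gamma> \<beta>) \<alpha> = vcomp_nat \<gamma> (vcomp_nat \<beta> \<alpha>)"
proof -
  interpret a: transformation C D \<alpha> by fact
  interpret b: transformation C D \<beta> by fact
  interpret c: transformation C D \<gamma> by fact
  note [simp] = assms(4,5) [symmetric]
  show ?thesis
    by (rule transformation_eqI [of C D])
      (auto intro!: a.D.cmp_assoc transformation_vcomp assms(1-3))
qed

lemma vcomp_nat_id:
  assumes "transformation C D \<alpha>"
  shows "vcomp_nat (id_nat (ntgt \<alpha>)) \<alpha> = \<alpha>" "vcomp_nat \<alpha> (id_nat (nsrc \<alpha>)) = \<alpha>"
proof -
  interpret a: transformation C D \<alpha> by fact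
  have "ide D (omap (ntgt \<alpha>) A) \<cdot>\<^bsub>D\<^esub> comps \<alpha> A = comps \<alpha> A"
    "comps \<alpha> A \<cdot>\<^bsub>D\<^esub> ide D (omap (nsrc \<alpha>) A) = comps \<alpha> A" if "A \<in> Ob C" for A
    using a.D.cmp_ide_left [of "comps \<alpha> A"] a.D.cmp_ide_right [of "comps \<alpha> A"] that by simp_all
  then show "vcomp_nat (id_nat (ntgt \<alpha>)) \<alpha> = \<alpha>" "vcomp_nat \<alpha> (id_nat (nsrc \<alpha>)) = \<alpha>"
    by (auto intro!: transformation_eqI [of C D] assms transformation_vcomp transformation_id
        a.A.F.is_functor_axioms a.A.G.is_functor_axioms)
qed

lemma hcomp_nat_id:
  assumes "is_functor F" "is_functor G" "Tgt F = Src G"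
  shows "hcomp_nat (id_nat G) (id_nat F) = id_nat (G \<circ>\<^sub>F F)"
proof -
  interpret F: is_functor F by fact
  interpret G: is_functor G by fact
  have "ide (Tgt G) (omap G (omap F A)) \<cdot>\<^bsub>Tgt G\<^esub> ide (Tgt G) (omap G (omap F A)) =
      ide (Tgt G) (omap G (omap F A))" if "A \<in> Ob (Src F)" for A
    using G.T.cmp_ide_left [of "ide (Tgt G) (omap G (omap F A))"] G.omap_in F.omap_in
      G.T.ide_in G.T.tgt_ide that assms(3) by simp
  then show ?thesis
    using assms F.omap_in G.amap_ide
    by (intro transformation_eqI [of "Src F" "Tgt G"] transformation_hcomp [of _ "Src G"]
        transformation_id is_functor_fcomp) auto
qed

lemma hcomp_nat_id_unit:
  assumes "transformation C D \<alpha>"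
  shows "hcomp_nat (id_nat (id_fnctr D)) \<alpha> = \<alpha>" "hcomp_nat \<alpha> (id_nat (id_fnctr C)) = \<alpha>"
proof -
  interpret a: transformation C D \<alpha> by fact
  have "ide D (omap (ntgt \<alpha>) A) \<cdot>\<^bsub>D\<^esub> comps \<alpha> A = comps \<alpha> A"
    "comps \<alpha> A \<cdot>\<^bsub>D\<^esub> ide D (omap (nsrc \<alpha>) A) = comps \<alpha> A" if "A \<in> Ob C" for A
    using a.D.cmp_ide_left [of "comps \<alpha> A"] a.D.cmp_ide_right [of "comps \<alpha> A"] that by simp_all
  then show "hcomp_nat (id_nat (id_fnctr D)) \<alpha> = \<alpha>" "hcomp_nat \<alpha> (id_nat (id_fnctr C)) = \<alpha>"
    using fcomp_id [OF a.A.F.is_functor_axioms] fcomp_id [OF a.A.G.is_functor_axioms]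
    by (auto intro!: transformation_eqI [of C D] assms transformation_hcomp transformation_id
        is_functor_id a.C.category_axioms a.D.category_axioms)
qed

lemma hcomp_nat_assoc:
  assumes "transformation B C \<alpha>" "transformation C D \<beta>" "transformation D E \<gamma>"
  shows "hcomp_nat (hcomp_nat \<gamma> \<beta>) \<alpha> = hcomp_nat \<gamma> (hcomp_nat \<beta> \<alpha>)"
proof -
  interpret a: transformation B C \<alpha> by fact
  interpret b: transformation C D \<beta> by fact
  interpret c: transformation D E \<gamma> by fact
  note functors = a.A.F.is_functor_axioms a.A.G.is_functor_axioms b.A.F.is_functor_axioms
    b.A.G.is_functor_axioms c.A.F.is_functor_axioms c.A.G.is_functor_axioms
  show ?thesis
  proof (rule transformation_eqI [of B E])
    fix A assume "A \<in> Ob B"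
    then show "comps (hcomp_nat (hcomp_nat \<gamma> \<beta>) \<alpha>) A = comps (hcomp_nat \<gamma> (hcomp_nat \<beta> \<alpha>)) A"
      by (simp add: c.D.cmp_assoc)
  qed (auto intro!: assms transformation_hcomp fcomp_assoc functors)
qed

text \<open>
  Both sides are composites of the four components of \<open>\<alpha>\<close>, \<open>\<alpha>'\<close>, \<open>\<beta>\<close> and \<open>\<beta>'\<close>; they differ in
  the middle, where naturality of \<open>\<beta>\<close> at the component of \<open>\<alpha>'\<close> exchanges the order.
\<close>

lemma nat_interchange:
  assumes "transformation C D \<alpha>" "transformation C D \<alpha>'"
    and "transformation D E \<beta>" "transformation D E \<beta>'"
    and "ntgt \<alpha> = nsrc \<alpha>'" "ntgt \<beta> = nsrc \<beta>'"
  shows "hcomp_nat (vcomp_nat \<beta>' \<beta>) (vcomp_nat \<alpha>' \<alpha>) =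
    vcomp_nat (hcomp_nat \<beta>' \<alpha>') (hcomp_nat \<beta> \<alpha>)"
proof -
  interpret a: transformation C D \<alpha> by fact
  interpret a': transformation C D \<alpha>' by fact
  interpret b: transformation D E \<beta> by fact
  interpret b': transformation D E \<beta>' by fact
  note [simp] = assms(5,6) [symmetric]
  show ?thesis
  proof (rule transformation_eqI [of C E])
    fix A assume A: "A \<in> Ob C"
    let ?z = "omap (ntgt \<alpha>') A"
    have "comps (hcomp_nat (vcomp_nat \<beta>' \<beta>) (vcomp_nat \<alpha>' \<alpha>)) A =
        (comps \<beta>' ?z \<cdot>\<^bsub>E\<^esub> comps \<beta> ?z) \<cdot>\<^bsub>E\<^esub> (amap (nsrc \<beta>) (comps \<alpha>' A) \<cdot>\<^bsub>E\<^esub> amap (nsrc \<beta>) (comps \<alpha> A))"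
      using A by simp
    also have "\<dots> = comps \<beta>' ?z \<cdot>\<^bsub>E\<^esub> (comps \<beta> ?z \<cdot>\<^bsub>E\<^esub> amap (nsrc \<beta>) (comps \<alpha>' A)) \<cdot>\<^bsub>E\<^esub> amap (nsrc \<beta>) (comps \<alpha> A)"
      using A by (simp add: b.D.cmp_assoc)
    also have "\<dots> = comps \<beta>' ?z \<cdot>\<^bsub>E\<^esub> (amap (ntgt \<beta>) (comps \<alpha>' A) \<cdot>\<^bsub>E\<^esub> comps \<beta> (omap (ntgt \<alpha>) A)) \<cdot>\<^bsub>E\<^esub> amap (nsrc \<beta>) (comps \<alpha> A)"
      using A b.naturality [of "comps \<alpha>' A"] by simp
    also have "\<dots> = comps (vcomp_nat (hcomp_nat \<beta>' \<alpha>') (hcomp_nat \<beta> \<alpha>)) A"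
      using A by (simp add: b.D.cmp_assoc)
    finally show "comps (hcomp_nat (vcomp_nat \<beta>' \<beta>) (vcomp_nat \<alpha>' \<alpha>)) A =
      comps (vcomp_nat (hcomp_nat \<beta>' \<alpha>') (hcomp_nat \<beta> \<alpha>)) A" .
  qed (auto intro!: transformation_hcomp transformation_vcomp assms(1-4))
qed

section \<open>The 2-category of fibrations\<close>

context cartesian_morphism
begin

lemma square_omap: "E \<in> Ob (Src (msrc H)) \<Longrightarrow> omap (mtgt H) (omap (total H) E) = omap (base H) (omap (msrc H) E)"
  using arg_cong [OF square, of "\<lambda>F. omap F E"] by (simp add: Src_total)

lemma square_amap: "e \<in> Ar (Src (msrc H)) \<Longrightarrow> amap (mtgt H) (amap (total H) e) = amap (base H) (amap (msrc H) e)"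
  using arg_cong [OF square, of "\<lambda>F. amap F e"] by (simp add: Src_total)

end

lemma cartesian_morphismI:
  assumes "fibration (msrc H)" "fibration (mtgt H)" "is_functor (total H)" "is_functor (base H)"
    and total: "Src (total H) = Src (msrc H)" "Tgt (total H) = Src (mtgt H)"
    and base: "Src (base H) = Tgt (msrc H)" "Tgt (base H) = Tgt (mtgt H)"
    and "\<And>E. E \<in> Ob (Src (msrc H)) \<Longrightarrow> omap (mtgt H) (omap (total H) E) = omap (base H) (omap (msrc H) E)"
    and "\<And>e. e \<in> Ar (Src (msrc H)) \<Longrightarrow> amap (mtgt H) (amap (total H) e) = amap (base H) (amap (msrc H) e)"
    and "\<And>\<phi>. cartesian (msrc H) \<phi> \<Longrightarrow> cartesian (mtgt H) (amap (total H) \<phi>)"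
  shows "cartesian_morphism H"
proof -
  have "mtgt H \<circ>\<^sub>F total H = base H \<circ>\<^sub>F msrc H"
    by (rule fnctr_eqI) (use assms in \<open>auto intro!: is_functor_fcomp simp: fibration_def\<close>)
  with assms show ?thesis
    by (simp add: cartesian_morphism_def cartesian_morphism_axioms_def)
qed

lemma cartesian_morphism_id:
  assumes "fibration Q"
  shows "cartesian_morphism (id_fib_mor Q)"
proof -
  interpret fibration Q by fact
  show ?thesis
    by (rule cartesian_morphismI)
      (auto simp: id_fib_mor_def assms omap_in amap_in cartesian_def intro!: is_functor_id
        S.category_axioms T.category_axioms)
qed

lemma comp_fib_mor_simps [simp]:
  "msrc (comp_fib_mor K H) = msrc H" "mtgt (comp_fib_mor K H) = mtgt K"
  "total (comp_fib_mor K H) = total K \<circ>\<^sub>F total H" "base (comp_fib_mor K H) = base K \<circ>\<^sub>F base H"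
  by (simp_all add: comp_fib_mor_def)

lemma id_fib_mor_simps [simp]:
  "msrc (id_fib_mor Q) = Q" "mtgt (id_fib_mor Q) = Q"
  "total (id_fib_mor Q) = id_fnctr (Src Q)" "base (id_fib_mor Q) = id_fnctr (Tgt Q)"
  by (simp_all add: id_fib_mor_def)

lemma cartesian_morphism_comp:
  assumes "cartesian_morphism H" "cartesian_morphism K" "mtgt H = msrc K"
  shows "cartesian_morphism (comp_fib_mor K H)"
proof -
  interpret H: cartesian_morphism H by fact
  interpret K: cartesian_morphism K by fact
  note [simp] = assms(3) [symmetric] H.Src_total H.Tgt_total H.Src_base H.Tgt_base
    K.Src_total K.Tgt_total K.Src_base K.Tgt_base
  note [simp] = H.total.omap_in [simplified] H.total.amap_in [simplified]
    H.source.omap_in H.source.amap_in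
    H.square_omap H.square_amap K.square_omap [simplified] K.square_amap [simplified]
  have "cartesian (mtgt K) (amap (total K) (amap (total H) \<phi>))" if "cartesian (msrc H) \<phi>" for \<phi>
    using that by (metis H.preserves_cartesian K.preserves_cartesian assms(3))
  then show ?thesis
    by (intro cartesian_morphismI)
      (auto intro!: is_functor_fcomp H.total.is_functor_axioms K.total.is_functor_axioms
        H.base.is_functor_axioms K.base.is_functor_axioms
        H.source.fibration_axioms K.target.fibration_axioms simp: cartesian_def)
qed

text \<open>
  A fibred cell consists of two transformations, and all operations on cells act separately
  on the two.  Hence the equational laws of a 2-category hold for cells because they hold for
  transformations, and only the compatibility with the projections needs an argument.
\<close>

lemma fibred_cell_transformations:
  assumes "fibred_cell \<alpha>"
  shows "transformation (Src (msrc (csrc \<alpha>))) (Src (mtgt (csrc \<alpha>))) (ctotal \<alpha>)"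
    and "transformation (Tgt (msrc (csrc \<alpha>))) (Tgt (mtgt (csrc \<alpha>))) (cbase \<alpha>)"
proof -
  interpret fibred_cell \<alpha> by fact
  show "transformation (Src (msrc (csrc \<alpha>))) (Src (mtgt (csrc \<alpha>))) (ctotal \<alpha>)"
    "transformation (Tgt (msrc (csrc \<alpha>))) (Tgt (mtgt (csrc \<alpha>))) (cbase \<alpha>)"
    by (auto intro!: transformationI total.natural_transformation_axioms
        base.natural_transformation_axioms
        simp: nsrc_total nsrc_base source.Src_total source.Tgt_total source.Src_base source.Tgt_base)
qed

lemma fibred_cellI:
  assumes "cartesian_morphism (csrc \<alpha>)" "cartesian_morphism (ctgt \<alpha>)"
    and "transformation C D (ctotal \<alpha>)" "transformation C' D' (cbase \<alpha>)"
    and "msrc (csrc \<alpha>) = msrc (ctgt \<alpha>)" "mtgt (csrc \<alpha>) = mtgt (ctgt \<alpha>)"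
    and "nsrc (ctotal \<alpha>) = total (csrc \<alpha>)" "ntgt (ctotal \<alpha>) = total (ctgt \<alpha>)"
    and "nsrc (cbase \<alpha>) = base (csrc \<alpha>)" "ntgt (cbase \<alpha>) = base (ctgt \<alpha>)"
    and "\<And>E. E \<in> Ob (Src (msrc (csrc \<alpha>))) \<Longrightarrow>
      amap (mtgt (csrc \<alpha>)) (comps (ctotal \<alpha>) E) = comps (cbase \<alpha>) (omap (msrc (csrc \<alpha>)) E)"
  shows "fibred_cell \<alpha>"
  using assms
  by (simp add: fibred_cell_def fibred_cell_axioms_def transformation_def)

lemma fib_cell_simps [simp]:
  "csrc (id_fib_cell H) = H" "ctgt (id_fib_cell H) = H"
  "ctotal (id_fib_cell H) = id_nat (total H)" "cbase (id_fib_cell H) = id_nat (base H)"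
  "csrc (vcomp_fib_cell \<beta> \<alpha>) = csrc \<alpha>" "ctgt (vcomp_fib_cell \<beta> \<alpha>) = ctgt \<beta>"
  "ctotal (vcomp_fib_cell \<beta> \<alpha>) = vcomp_nat (ctotal \<beta>) (ctotal \<alpha>)"
  "cbase (vcomp_fib_cell \<beta> \<alpha>) = vcomp_nat (cbase \<beta>) (cbase \<alpha>)"
  "csrc (hcomp_fib_cell \<beta> \<alpha>) = comp_fib_mor (csrc \<beta>) (csrc \<alpha>)"
  "ctgt (hcomp_fib_cell \<beta> \<alpha>) = comp_fib_mor (ctgt \<beta>) (ctgt \<alpha>)"
  "ctotal (hcomp_fib_cell \<beta> \<alpha>) = hcomp_nat (ctotal \<beta>) (ctotal \<alpha>)"
  "cbase (hcomp_fib_cell \<beta> \<alpha>) = hcomp_nat (cbase \<beta>) (cbase \<alpha>)"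
  by (simp_all add: id_fib_cell_def vcomp_fib_cell_def hcomp_fib_cell_def)

lemma fibred_cell_id:
  assumes "cartesian_morphism H"
  shows "fibred_cell (id_fib_cell H)"
proof -
  interpret cartesian_morphism H by fact
  note [simp] = Src_total Tgt_total Src_base Tgt_base
  have "amap (mtgt H) (ide (Tgt (total H)) (omap (total H) E)) =
      ide (Tgt (base H)) (omap (base H) (omap (msrc H) E))" if "E \<in> Ob (Src (msrc H))" for E
    using that total.omap_in square_omap by (simp add: target.amap_ide)
  then show ?thesis
    by (intro fibred_cellI [of _ "Src (total H)" "Tgt (total H)" "Src (base H)" "Tgt (base H)"])
      (auto intro!: assms transformation_id total.is_functor_axioms base.is_functor_axioms
        simp: source.omap_in)
qed

lemma fibred_cell_vcomp:
  assumes "fibred_cell \<alpha>" "fibred_cell \<beta>" "ctgt \<alpha> = csrc \<beta>"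
  shows "fibred_cell (vcomp_fib_cell \<beta> \<alpha>)"
proof -
  interpret a: fibred_cell \<alpha> by fact
  interpret b: fibred_cell \<beta> by fact
  let ?M = "msrc (csrc \<alpha>)" and ?N = "mtgt (csrc \<alpha>)"
  have eqs [simp]: "msrc (csrc \<beta>) = ?M" "mtgt (csrc \<beta>) = ?N"
    "msrc (ctgt \<beta>) = ?M" "mtgt (ctgt \<beta>) = ?N"
    using assms(3) a.same_msrc a.same_mtgt b.same_msrc b.same_mtgt by auto
  interpret ta: transformation "Src ?M" "Src ?N" "ctotal \<alpha>"
    using fibred_cell_transformations [OF assms(1)] by simp
  interpret tb: transformation "Src ?M" "Src ?N" "ctotal \<beta>"
    using fibred_cell_transformations [OF assms(2)] by simp
  interpret ba: transformation "Tgt ?M" "Tgt ?N" "cbase \<alpha>"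
    using fibred_cell_transformations [OF assms(1)] by simp
  interpret bb: transformation "Tgt ?M" "Tgt ?N" "cbase \<beta>"
    using fibred_cell_transformations [OF assms(2)] by simp
  have mid: "ntgt (ctotal \<alpha>) = nsrc (ctotal \<beta>)" "ntgt (cbase \<alpha>) = nsrc (cbase \<beta>)"
    by (simp_all add: a.ntgt_total b.nsrc_total a.ntgt_base b.nsrc_base assms(3))
  have "amap ?N (comps (ctotal \<beta>) E \<cdot>\<^bsub>Src ?N\<^esub> comps (ctotal \<alpha>) E) =
      comps (cbase \<beta>) (omap ?M E) \<cdot>\<^bsub>Tgt ?N\<^esub> comps (cbase \<alpha>) (omap ?M E)" if "E \<in> Ob (Src ?M)" for E
    using that by (subst a.source.target.amap_cmp) (auto simp: mid a.lies_over b.lies_over [simplified])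
  then show ?thesis
    by (intro fibred_cellI [of _ "Src ?M" "Src ?N" "Tgt ?M" "Tgt ?N"])
      (auto intro!: transformation_vcomp simp: a.source.Src_total a.source.Tgt_total
        a.source.Src_base a.source.Tgt_base a.source.cartesian_morphism_axioms b.target.cartesian_morphism_axioms
        ta.transformation_axioms tb.transformation_axioms ba.transformation_axioms
        bb.transformation_axioms mid a.nsrc_total b.ntgt_total a.nsrc_base b.ntgt_base
        a.source.source.omap_in)
qed

lemma fibred_cell_hcomp:
  assumes "fibred_cell \<alpha>" "fibred_cell \<beta>" "mtgt (csrc \<alpha>) = msrc (csrc \<beta>)"
  shows "fibred_cell (hcomp_fib_cell \<beta> \<alpha>)"
proof -
  interpret a: fibred_cell \<alpha> by fact
  interpret b: fibred_cell \<beta> by fact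
  let ?L = "msrc (csrc \<alpha>)" and ?M = "msrc (csrc \<beta>)" and ?N = "mtgt (csrc \<beta>)"
  note eqs [simp] = assms(3) a.same_msrc [symmetric] a.same_mtgt [symmetric]
    b.same_msrc [symmetric] b.same_mtgt [symmetric]
  interpret ta: transformation "Src ?L" "Src ?M" "ctotal \<alpha>"
    using fibred_cell_transformations [OF assms(1)] by simp
  interpret tb: transformation "Src ?M" "Src ?N" "ctotal \<beta>"
    using fibred_cell_transformations [OF assms(2)] by simp
  interpret ba: transformation "Tgt ?L" "Tgt ?M" "cbase \<alpha>"
    using fibred_cell_transformations [OF assms(1)] by simp
  interpret bb: transformation "Tgt ?M" "Tgt ?N" "cbase \<beta>"
    using fibred_cell_transformations [OF assms(2)] by simp
  have "amap ?N (comps (ctotal \<beta>) (omap (ntgt (ctotal \<alpha>)) E) \<cdot>\<^bsub>Src ?N\<^esub>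
        amap (nsrc (ctotal \<beta>)) (comps (ctotal \<alpha>) E)) =
      comps (cbase \<beta>) (omap (ntgt (cbase \<alpha>)) (omap ?L E)) \<cdot>\<^bsub>Tgt ?N\<^esub>
        amap (nsrc (cbase \<beta>)) (comps (cbase \<alpha>) (omap ?L E))" if E: "E \<in> Ob (Src ?L)" for E
  proof -
    have over: "omap ?M (omap (ntgt (ctotal \<alpha>)) E) = omap (ntgt (cbase \<alpha>)) (omap ?L E)"
      using a.target.square_omap [of E] E by (simp add: a.ntgt_total a.ntgt_base)
    have "amap ?N (amap (nsrc (ctotal \<beta>)) (comps (ctotal \<alpha>) E)) =
        amap (nsrc (cbase \<beta>)) (comps (cbase \<alpha>) (omap ?L E))"
      using b.source.square_amap [of "comps (ctotal \<alpha>) E"] a.lies_over [of E] E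
      by (simp add: b.nsrc_total b.nsrc_base)
    with over show ?thesis
      using E by (subst b.source.target.amap_cmp) (auto simp: b.lies_over)
  qed
  then show ?thesis
    by (intro fibred_cellI [of _ "Src ?L" "Src ?N" "Tgt ?L" "Tgt ?N"])
      (auto simp: a.source.Src_total a.source.Src_base b.source.Tgt_total b.source.Tgt_base ta.transformation_axioms tb.transformation_axioms ba.transformation_axioms
        bb.transformation_axioms a.nsrc_total b.ntgt_total a.nsrc_base b.ntgt_base
        b.nsrc_total a.ntgt_total b.nsrc_base a.ntgt_base a.source.source.omap_in
        intro!: transformation_hcomp [of _ "Src ?M"] transformation_hcomp [of _ "Tgt ?M"]
        cartesian_morphism_comp a.source.cartesian_morphism_axioms
        b.target.cartesian_morphism_axioms a.target.cartesian_morphism_axioms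
        b.source.cartesian_morphism_axioms)
qed

lemma comp_fib_mor_assoc:
  assumes "cartesian_morphism F" "cartesian_morphism G" "cartesian_morphism H"
    and "mtgt F = msrc G" "mtgt G = msrc H"
  shows "comp_fib_mor (comp_fib_mor H G) F = comp_fib_mor H (comp_fib_mor G F)"
proof -
  interpret F: cartesian_morphism F by fact
  interpret G: cartesian_morphism G by fact
  interpret H: cartesian_morphism H by fact
  show ?thesis
    using assms(4,5) F.Tgt_total F.Tgt_base G.Src_total G.Src_base G.Tgt_total G.Tgt_base H.Src_total
      H.Src_base fcomp_assoc [OF F.total.is_functor_axioms G.total.is_functor_axioms H.total.is_functor_axioms]
      fcomp_assoc [OF F.base.is_functor_axioms G.base.is_functor_axioms H.base.is_functor_axioms]
    by (intro fib_mor.equality) auto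
qed

lemma comp_fib_mor_id:
  assumes "cartesian_morphism H"
  shows "comp_fib_mor H (id_fib_mor (msrc H)) = H" "comp_fib_mor (id_fib_mor (mtgt H)) H = H"
proof -
  interpret cartesian_morphism H by fact
  show "comp_fib_mor H (id_fib_mor (msrc H)) = H" "comp_fib_mor (id_fib_mor (mtgt H)) H = H"
    using fcomp_id [OF total.is_functor_axioms] fcomp_id [OF base.is_functor_axioms]
      Src_total Tgt_total Src_base Tgt_base by (auto intro!: fib_mor.equality)
qed

lemma fibred_cellD:
  assumes "fibred_cell \<alpha>"
  shows "cartesian_morphism (csrc \<alpha>)" "cartesian_morphism (ctgt \<alpha>)"
    "msrc (ctgt \<alpha>) = msrc (csrc \<alpha>)" "mtgt (ctgt \<alpha>) = mtgt (csrc \<alpha>)"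
    "nsrc (ctotal \<alpha>) = total (csrc \<alpha>)" "ntgt (ctotal \<alpha>) = total (ctgt \<alpha>)"
    "nsrc (cbase \<alpha>) = base (csrc \<alpha>)" "ntgt (cbase \<alpha>) = base (ctgt \<alpha>)"
  using assms by (simp_all add: fibred_cell_def fibred_cell_axioms_def)

lemma vcomp_fib_cell_assoc:
  assumes "fibred_cell \<alpha>" "fibred_cell \<beta>" "fibred_cell \<gamma>" "ctgt \<alpha> = csrc \<beta>" "ctgt \<beta> = csrc \<gamma>"
  shows "vcomp_fib_cell (vcomp_fib_cell \<gamma> \<beta>) \<alpha> = vcomp_fib_cell \<gamma> (vcomp_fib_cell \<beta> \<alpha>)"
proof -
  have "msrc (csrc \<beta>) = msrc (csrc \<alpha>)" "mtgt (csrc \<beta>) = mtgt (csrc \<alpha>)"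
    "msrc (csrc \<gamma>) = msrc (csrc \<alpha>)" "mtgt (csrc \<gamma>) = mtgt (csrc \<alpha>)"
    using assms by (metis fibred_cellD(3,4))+
  then show ?thesis
    using fibred_cell_transformations [OF assms(1)] fibred_cell_transformations [OF assms(2)]
      fibred_cell_transformations [OF assms(3)] assms
    by (auto intro!: fib_cell.equality vcomp_nat_assoc simp: fibred_cellD)
qed

lemma vcomp_fib_cell_id:
  assumes "fibred_cell \<alpha>"
  shows "vcomp_fib_cell (id_fib_cell (ctgt \<alpha>)) \<alpha> = \<alpha>" "vcomp_fib_cell \<alpha> (id_fib_cell (csrc \<alpha>)) = \<alpha>"
  using fibred_cell_transformations [OF assms, THEN vcomp_nat_id(1)]
    fibred_cell_transformations [OF assms, THEN vcomp_nat_id(2)]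
  by (auto intro!: fib_cell.equality simp: fibred_cellD [OF assms])

lemma hcomp_fib_cell_assoc:
  assumes "fibred_cell \<alpha>" "fibred_cell \<beta>" "fibred_cell \<gamma>"
    and "mtgt (csrc \<alpha>) = msrc (csrc \<beta>)" "mtgt (csrc \<beta>) = msrc (csrc \<gamma>)"
  shows "hcomp_fib_cell (hcomp_fib_cell \<gamma> \<beta>) \<alpha> = hcomp_fib_cell \<gamma> (hcomp_fib_cell \<beta> \<alpha>)"
proof -
  have "hcomp_nat (hcomp_nat (ctotal \<gamma>) (ctotal \<beta>)) (ctotal \<alpha>) =
      hcomp_nat (ctotal \<gamma>) (hcomp_nat (ctotal \<beta>) (ctotal \<alpha>))"
    "hcomp_nat (hcomp_nat (cbase \<gamma>) (cbase \<beta>)) (cbase \<alpha>) =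
      hcomp_nat (cbase \<gamma>) (hcomp_nat (cbase \<beta>) (cbase \<alpha>))"
    using fibred_cell_transformations [OF assms(1)] fibred_cell_transformations [OF assms(2)]
      fibred_cell_transformations [OF assms(3)] assms(4,5) by (metis hcomp_nat_assoc)+
  then show ?thesis
    using assms by (auto intro!: fib_cell.equality comp_fib_mor_assoc simp: fibred_cellD)
qed

lemma hcomp_fib_cell_id:
  assumes "cartesian_morphism H" "cartesian_morphism K" "mtgt H = msrc K"
  shows "hcomp_fib_cell (id_fib_cell K) (id_fib_cell H) = id_fib_cell (comp_fib_mor K H)"
proof -
  interpret H: cartesian_morphism H by fact
  interpret K: cartesian_morphism K by fact
  show ?thesis
    using assms(3) by (auto intro!: fib_cell.equality hcomp_nat_id H.total.is_functor_axioms
        K.total.is_functor_axioms H.base.is_functor_axioms K.base.is_functor_axioms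
        simp: H.Tgt_total K.Src_total H.Tgt_base K.Src_base)
qed

lemma hcomp_fib_cell_id_unit:
  assumes "fibred_cell \<alpha>"
  shows "hcomp_fib_cell (id_fib_cell (id_fib_mor (mtgt (csrc \<alpha>)))) \<alpha> = \<alpha>"
    and "hcomp_fib_cell \<alpha> (id_fib_cell (id_fib_mor (msrc (csrc \<alpha>)))) = \<alpha>"
  using fibred_cell_transformations [OF assms, THEN hcomp_nat_id_unit(1)]
    fibred_cell_transformations [OF assms, THEN hcomp_nat_id_unit(2)]
    comp_fib_mor_id [OF fibred_cellD(1) [OF assms]] comp_fib_mor_id [OF fibred_cellD(2) [OF assms]]
  by (auto intro!: fib_cell.equality simp: fibred_cellD(3,4) [OF assms])

lemma fib_cell_interchange:
  assumes "fibred_cell \<alpha>" "fibred_cell \<alpha>'" "fibred_cell \<beta>" "fibred_cell \<beta>'"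
    and "ctgt \<alpha> = csrc \<alpha>'" "ctgt \<beta> = csrc \<beta>'" "mtgt (csrc \<alpha>) = msrc (csrc \<beta>)"
  shows "hcomp_fib_cell (vcomp_fib_cell \<beta>' \<beta>) (vcomp_fib_cell \<alpha>' \<alpha>) =
    vcomp_fib_cell (hcomp_fib_cell \<beta>' \<alpha>') (hcomp_fib_cell \<beta> \<alpha>)"
proof -
  have eqs: "msrc (csrc \<alpha>') = msrc (csrc \<alpha>)" "mtgt (csrc \<alpha>') = mtgt (csrc \<alpha>)"
    "msrc (csrc \<beta>') = mtgt (csrc \<alpha>)" "msrc (csrc \<beta>) = mtgt (csrc \<alpha>)" "mtgt (csrc \<beta>') = mtgt (csrc \<beta>)"
    using assms by (metis fibred_cellD(3,4))+
  have mid: "ntgt (ctotal \<alpha>) = nsrc (ctotal \<alpha>')" "ntgt (cbase \<alpha>) = nsrc (cbase \<alpha>')"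
    "ntgt (ctotal \<beta>) = nsrc (ctotal \<beta>')" "ntgt (cbase \<beta>) = nsrc (cbase \<beta>')"
    using assms by (simp_all add: fibred_cellD)
  note tr = fibred_cell_transformations [OF assms(1)] fibred_cell_transformations [OF assms(2), unfolded eqs]
    fibred_cell_transformations [OF assms(3), unfolded eqs] fibred_cell_transformations [OF assms(4), unfolded eqs]
  show ?thesis
    using nat_interchange [OF tr(1,3,5,7) mid(1,3)] nat_interchange [OF tr(2,4,6,8) mid(2,4)]
    by (auto intro!: fib_cell.equality)
qed

lemma two_category_FIBc: "two_category FIBc"
proof -
  have "category (cells1 FIBc)"
    by unfold_locales
      (auto simp: FIBc_def comp_fib_mor_id cartesian_morphism_id cartesian_morphism_comp
        comp_fib_mor_assoc cartesian_morphism.axioms(1,2))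
  moreover have "category (cells2 FIBc)"
    by unfold_locales
      (auto simp: FIBc_def fibred_cellD(1,2) fibred_cell_id fibred_cell_vcomp vcomp_fib_cell_assoc
        vcomp_fib_cell_id)
  moreover have "category (horizontal_cat FIBc)"
    by unfold_locales
      (auto simp: FIBc_def horizontal_cat_def fibred_cellD cartesian_morphism.axioms(1,2)
        cartesian_morphism_id fibred_cell_id fibred_cell_hcomp hcomp_fib_cell_assoc hcomp_fib_cell_id_unit)
  ultimately show ?thesis
    by (intro two_category.intro two_category_axioms.intro)
      (auto simp: FIBc_def fibred_cellD(3,4) hcomp_fib_cell_id fib_cell_interchange)
qed

section \<open>Cartesian arrows\<close>

context is_functor
begin

lemmas functor_rules =
  omap_in amap_in src_amap tgt_amap amap_ide amap_cmp
  S.src_in S.tgt_in S.ide_in S.src_ide S.tgt_ide S.cmp_in S.src_cmp S.tgt_cmp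
  T.src_in T.tgt_in T.ide_in T.src_ide T.tgt_ide T.cmp_in T.src_cmp T.tgt_cmp
  S.cmp_ide_right S.cmp_ide_left T.cmp_ide_right T.cmp_ide_left

lemma cartesian_arrow: "cartesian F \<phi> \<Longrightarrow> \<phi> \<in> Ar (Src F)"
  by (simp add: cartesian_def)

text \<open>
  The uniqueness half of the universal property: equality of arrows into the source of a
  Cartesian arrow can be tested after composition with it, if it holds in the base.
\<close>

lemma cartesian_cancel:
  assumes \<phi>: "cartesian F \<phi>"
    and \<chi>: "\<chi> \<in> Ar (Src F)" "tgt (Src F) \<chi> = src (Src F) \<phi>"
    and \<chi>': "\<chi>' \<in> Ar (Src F)" "tgt (Src F) \<chi>' = src (Src F) \<phi>"
    and eq: "src (Src F) \<chi> = src (Src F) \<chi>'" "amap F \<chi> = amap F \<chi>'"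
      "\<phi> \<cdot>\<^bsub>Src F\<^esub> \<chi> = \<phi> \<cdot>\<^bsub>Src F\<^esub> \<chi>'"
  shows "\<chi> = \<chi>'"
proof -
  note [simp] = functor_rules cartesian_arrow [OF \<phi>]
  have "\<exists>!\<xi>. \<xi> \<in> Ar (Src F) \<and> src (Src F) \<xi> = src (Src F) (\<phi> \<cdot>\<^bsub>Src F\<^esub> \<chi>) \<and>
      tgt (Src F) \<xi> = src (Src F) \<phi> \<and> amap F \<xi> = amap F \<chi> \<and> \<phi> \<cdot>\<^bsub>Src F\<^esub> \<xi> = \<phi> \<cdot>\<^bsub>Src F\<^esub> \<chi>"
    by (rule \<phi> [unfolded cartesian_def, THEN conjunct2, rule_format]) (simp_all add: \<chi>)
  moreover have "src (Src F) (\<phi> \<cdot>\<^bsub>Src F\<^esub> \<chi>) = src (Src F) \<chi>"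
    using \<chi> by simp
  ultimately show ?thesis
    using assms by metis
qed

lemma factor_cartesian:
  assumes "cartesian F \<phi>" "\<psi> \<in> Ar (Src F)" "h \<in> Ar (Tgt F)" "tgt (Src F) \<psi> = tgt (Src F) \<phi>"
    and "src (Tgt F) h = omap F (src (Src F) \<psi>)" "tgt (Tgt F) h = omap F (src (Src F) \<phi>)"
    and "amap F \<psi> = amap F \<phi> \<cdot>\<^bsub>Tgt F\<^esub> h"
  shows "factor F \<phi> h \<psi> \<in> Ar (Src F)" "src (Src F) (factor F \<phi> h \<psi>) = src (Src F) \<psi>"
    "tgt (Src F) (factor F \<phi> h \<psi>) = src (Src F) \<phi>" "amap F (factor F \<phi> h \<psi>) = h"
    "\<phi> \<cdot>\<^bsub>Src F\<^esub> factor F \<phi> h \<psi> = \<psi>"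
proof -
  have "\<exists>!\<chi>. \<chi> \<in> Ar (Src F) \<and> src (Src F) \<chi> = src (Src F) \<psi> \<and> tgt (Src F) \<chi> = src (Src F) \<phi> \<and>
      amap F \<chi> = h \<and> \<phi> \<cdot>\<^bsub>Src F\<^esub> \<chi> = \<psi>"
    using assms unfolding cartesian_def by blast
  from theI' [OF this, folded factor_def]
  show "factor F \<phi> h \<psi> \<in> Ar (Src F)" "src (Src F) (factor F \<phi> h \<psi>) = src (Src F) \<psi>"
    "tgt (Src F) (factor F \<phi> h \<psi>) = src (Src F) \<phi>" "amap F (factor F \<phi> h \<psi>) = h"
    "\<phi> \<cdot>\<^bsub>Src F\<^esub> factor F \<phi> h \<psi> = \<psi>"
    by blast+
qed

lemma cartesianI:
  assumes "\<phi> \<in> Ar (Src F)"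
    and factors: "\<And>\<psi> h. \<lbrakk>\<psi> \<in> Ar (Src F); h \<in> Ar (Tgt F); tgt (Src F) \<psi> = tgt (Src F) \<phi>;
        src (Tgt F) h = omap F (src (Src F) \<psi>); tgt (Tgt F) h = omap F (src (Src F) \<phi>);
        amap F \<psi> = amap F \<phi> \<cdot>\<^bsub>Tgt F\<^esub> h\<rbrakk> \<Longrightarrow>
      \<exists>\<chi>. \<chi> \<in> Ar (Src F) \<and> src (Src F) \<chi> = src (Src F) \<psi> \<and> tgt (Src F) \<chi> = src (Src F) \<phi> \<and>
        amap F \<chi> = h \<and> \<phi> \<cdot>\<^bsub>Src F\<^esub> \<chi> = \<psi>"
    and cancel: "\<And>\<chi> \<chi>'. \<lbrakk>\<chi> \<in> Ar (Src F); tgt (Src F) \<chi> = src (Src F) \<phi>;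
        \<chi>' \<in> Ar (Src F); tgt (Src F) \<chi>' = src (Src F) \<phi>;
        src (Src F) \<chi> = src (Src F) \<chi>'; amap F \<chi> = amap F \<chi>';
        \<phi> \<cdot>\<^bsub>Src F\<^esub> \<chi> = \<phi> \<cdot>\<^bsub>Src F\<^esub> \<chi>'\<rbrakk> \<Longrightarrow> \<chi> = \<chi>'"
  shows "cartesian F \<phi>"
  unfolding cartesian_def
proof (intro conjI ballI impI)
  fix \<psi> h assume "\<psi> \<in> Ar (Src F)" "h \<in> Ar (Tgt F)" "tgt (Src F) \<psi> = tgt (Src F) \<phi>"
    "src (Tgt F) h = omap F (src (Src F) \<psi>)" "tgt (Tgt F) h = omap F (src (Src F) \<phi>)"
    "amap F \<psi> = amap F \<phi> \<cdot>\<^bsub>Tgt F\<^esub> h"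
  from factors [OF this] cancel
  show "\<exists>!\<chi>. \<chi> \<in> Ar (Src F) \<and> src (Src F) \<chi> = src (Src F) \<psi> \<and> tgt (Src F) \<chi> = src (Src F) \<phi> \<and>
      amap F \<chi> = h \<and> \<phi> \<cdot>\<^bsub>Src F\<^esub> \<chi> = \<psi>"
    by (elim exE, intro ex1I) (blast, metis)
qed (fact assms(1))

lemma cartesian_comp:
  assumes \<phi>: "cartesian F \<phi>" and \<theta>: "cartesian F \<theta>" and comp: "tgt (Src F) \<phi> = src (Src F) \<theta>"
  shows "cartesian F (\<theta> \<cdot>\<^bsub>Src F\<^esub> \<phi>)"
proof (rule cartesianI)
  note [simp] = functor_rules cartesian_arrow [OF \<phi>] cartesian_arrow [OF \<theta>] comp
    T.cmp_assoc S.cmp_assoc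
  show "\<theta> \<cdot>\<^bsub>Src F\<^esub> \<phi> \<in> Ar (Src F)" by simp
  { fix \<psi> h assume \<psi>: "\<psi> \<in> Ar (Src F)" "h \<in> Ar (Tgt F)" "tgt (Src F) \<psi> = tgt (Src F) (\<theta> \<cdot>\<^bsub>Src F\<^esub> \<phi>)"
      "src (Tgt F) h = omap F (src (Src F) \<psi>)" "tgt (Tgt F) h = omap F (src (Src F) (\<theta> \<cdot>\<^bsub>Src F\<^esub> \<phi>))"
      "amap F \<psi> = amap F (\<theta> \<cdot>\<^bsub>Src F\<^esub> \<phi>) \<cdot>\<^bsub>Tgt F\<^esub> h"
    let ?\<xi> = "factor F \<theta> (amap F \<phi> \<cdot>\<^bsub>Tgt F\<^esub> h) \<psi>"
    have \<xi>: "?\<xi> \<in> Ar (Src F)" "src (Src F) ?\<xi> = src (Src F) \<psi>" "tgt (Src F) ?\<xi> = src (Src F) \<theta>"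
      "amap F ?\<xi> = amap F \<phi> \<cdot>\<^bsub>Tgt F\<^esub> h" "\<theta> \<cdot>\<^bsub>Src F\<^esub> ?\<xi> = \<psi>"
      using \<psi> by (intro factor_cartesian [OF \<theta>]; simp)+
    let ?\<chi> = "factor F \<phi> h ?\<xi>"
    have \<chi>: "?\<chi> \<in> Ar (Src F)" "src (Src F) ?\<chi> = src (Src F) ?\<xi>" "tgt (Src F) ?\<chi> = src (Src F) \<phi>"
      "amap F ?\<chi> = h" "\<phi> \<cdot>\<^bsub>Src F\<^esub> ?\<chi> = ?\<xi>"
      using \<psi> \<xi> by (intro factor_cartesian [OF \<phi>]; simp)+
    show "\<exists>\<chi>. \<chi> \<in> Ar (Src F) \<and> src (Src F) \<chi> = src (Src F) \<psi> \<and> tgt (Src F) \<chi> = src (Src F) (\<theta> \<cdot>\<^bsub>Src F\<^esub> \<phi>) \<and>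
        amap F \<chi> = h \<and> (\<theta> \<cdot>\<^bsub>Src F\<^esub> \<phi>) \<cdot>\<^bsub>Src F\<^esub> \<chi> = \<psi>"
      using \<chi> \<xi> by (intro exI [of _ ?\<chi>]) simp }
  fix \<chi> \<chi>' assume \<chi>: "\<chi> \<in> Ar (Src F)" "tgt (Src F) \<chi> = src (Src F) (\<theta> \<cdot>\<^bsub>Src F\<^esub> \<phi>)"
    "\<chi>' \<in> Ar (Src F)" "tgt (Src F) \<chi>' = src (Src F) (\<theta> \<cdot>\<^bsub>Src F\<^esub> \<phi>)"
    "src (Src F) \<chi> = src (Src F) \<chi>'" "amap F \<chi> = amap F \<chi>'"
    "(\<theta> \<cdot>\<^bsub>Src F\<^esub> \<phi>) \<cdot>\<^bsub>Src F\<^esub> \<chi> = (\<theta> \<cdot>\<^bsub>Src F\<^esub> \<phi>) \<cdot>\<^bsub>Src F\<^esub> \<chi>'"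
  have "\<phi> \<cdot>\<^bsub>Src F\<^esub> \<chi> = \<phi> \<cdot>\<^bsub>Src F\<^esub> \<chi>'"
    using \<chi> by - (rule cartesian_cancel [OF \<theta>]; simp)
  with \<chi> show "\<chi> = \<chi>'"
    by - (rule cartesian_cancel [OF \<phi>]; simp)
qed

text \<open>
  An arrow \<open>\<psi>\<close> that should factor through \<open>\<phi>\<close> gives \<open>\<theta>\<psi>\<close>, which factors through \<open>\<theta>\<phi>\<close>; and \<open>\<theta>\<close>
  can be cancelled from the result.
\<close>

lemma cartesian_right_factor:
  assumes \<phi>: "\<phi> \<in> Ar (Src F)" and \<theta>: "cartesian F \<theta>" and comp: "tgt (Src F) \<phi> = src (Src F) \<theta>"
    and composite: "cartesian F (\<theta> \<cdot>\<^bsub>Src F\<^esub> \<phi>)"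
  shows "cartesian F \<phi>"
proof (rule cartesianI)
  note [simp] = functor_rules \<phi> cartesian_arrow [OF \<theta>] comp T.cmp_assoc S.cmp_assoc
  { fix \<psi> h assume \<psi>: "\<psi> \<in> Ar (Src F)" "h \<in> Ar (Tgt F)" "tgt (Src F) \<psi> = tgt (Src F) \<phi>"
      "src (Tgt F) h = omap F (src (Src F) \<psi>)" "tgt (Tgt F) h = omap F (src (Src F) \<phi>)"
      "amap F \<psi> = amap F \<phi> \<cdot>\<^bsub>Tgt F\<^esub> h"
    let ?\<chi> = "factor F (\<theta> \<cdot>\<^bsub>Src F\<^esub> \<phi>) h (\<theta> \<cdot>\<^bsub>Src F\<^esub> \<psi>)"
    have \<chi>: "?\<chi> \<in> Ar (Src F)" "src (Src F) ?\<chi> = src (Src F) (\<theta> \<cdot>\<^bsub>Src F\<^esub> \<psi>)"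
      "tgt (Src F) ?\<chi> = src (Src F) (\<theta> \<cdot>\<^bsub>Src F\<^esub> \<phi>)" "amap F ?\<chi> = h"
      "(\<theta> \<cdot>\<^bsub>Src F\<^esub> \<phi>) \<cdot>\<^bsub>Src F\<^esub> ?\<chi> = \<theta> \<cdot>\<^bsub>Src F\<^esub> \<psi>"
      using \<psi> by (intro factor_cartesian [OF composite]; simp)+
    have "\<phi> \<cdot>\<^bsub>Src F\<^esub> ?\<chi> = \<psi>"
      using \<psi> \<chi> by - (rule cartesian_cancel [OF \<theta>]; simp)
    with \<chi> \<psi> show "\<exists>\<chi>. \<chi> \<in> Ar (Src F) \<and> src (Src F) \<chi> = src (Src F) \<psi> \<and> tgt (Src F) \<chi> = src (Src F) \<phi> \<and>
        amap F \<chi> = h \<and> \<phi> \<cdot>\<^bsub>Src F\<^esub> \<chi> = \<psi>"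
      by (intro exI [of _ ?\<chi>]) simp }
  fix \<chi> \<chi>' assume "\<chi> \<in> Ar (Src F)" "tgt (Src F) \<chi> = src (Src F) \<phi>"
    "\<chi>' \<in> Ar (Src F)" "tgt (Src F) \<chi>' = src (Src F) \<phi>"
    "src (Src F) \<chi> = src (Src F) \<chi>'" "amap F \<chi> = amap F \<chi>'" "\<phi> \<cdot>\<^bsub>Src F\<^esub> \<chi> = \<phi> \<cdot>\<^bsub>Src F\<^esub> \<chi>'"
  then show "\<chi> = \<chi>'"
    by - (rule cartesian_cancel [OF composite]; simp)
qed (fact \<phi>)

lemma cartesian_iso:
  assumes f: "f \<in> Ar (Src F)" and g: "g \<in> Ar (Src F)"
    and ends: "src (Src F) g = tgt (Src F) f" "tgt (Src F) g = src (Src F) f"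
    and gf: "g \<cdot>\<^bsub>Src F\<^esub> f = ide (Src F) (src (Src F) f)" and fg: "f \<cdot>\<^bsub>Src F\<^esub> g = ide (Src F) (tgt (Src F) f)"
  shows "cartesian F f"
proof (rule cartesianI)
  note [simp] = functor_rules f g ends
  { fix \<psi> h assume \<psi>: "\<psi> \<in> Ar (Src F)" "h \<in> Ar (Tgt F)" "tgt (Src F) \<psi> = tgt (Src F) f"
      "src (Tgt F) h = omap F (src (Src F) \<psi>)" "tgt (Tgt F) h = omap F (src (Src F) f)"
      "amap F \<psi> = amap F f \<cdot>\<^bsub>Tgt F\<^esub> h"
    have "amap F g \<cdot>\<^bsub>Tgt F\<^esub> amap F f \<cdot>\<^bsub>Tgt F\<^esub> h = amap F (g \<cdot>\<^bsub>Src F\<^esub> f) \<cdot>\<^bsub>Tgt F\<^esub> h"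
      using \<psi> by (simp add: T.cmp_assoc)
    also have "\<dots> = h"
      using \<psi> T.cmp_ide_left [of h] by (simp add: gf)
    finally have "amap F (g \<cdot>\<^bsub>Src F\<^esub> \<psi>) = h"
      using \<psi> by simp
    moreover have "f \<cdot>\<^bsub>Src F\<^esub> g \<cdot>\<^bsub>Src F\<^esub> \<psi> = \<psi>"
      using \<psi> S.cmp_ide_left [of \<psi>] by (subst S.cmp_assoc [symmetric]) (simp_all add: fg)
    ultimately show "\<exists>\<chi>. \<chi> \<in> Ar (Src F) \<and> src (Src F) \<chi> = src (Src F) \<psi> \<and> tgt (Src F) \<chi> = src (Src F) f \<and>
        amap F \<chi> = h \<and> f \<cdot>\<^bsub>Src F\<^esub> \<chi> = \<psi>"
      using \<psi> by (intro exI [of _ "g \<cdot>\<^bsub>Src F\<^esub> \<psi>"]) simp }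
  fix \<chi> \<chi>' assume \<chi>: "\<chi> \<in> Ar (Src F)" "tgt (Src F) \<chi> = src (Src F) f"
    "\<chi>' \<in> Ar (Src F)" "tgt (Src F) \<chi>' = src (Src F) f" "f \<cdot>\<^bsub>Src F\<^esub> \<chi> = f \<cdot>\<^bsub>Src F\<^esub> \<chi>'"
  have "g \<cdot>\<^bsub>Src F\<^esub> f \<cdot>\<^bsub>Src F\<^esub> \<xi> = \<xi>" if "\<xi> \<in> Ar (Src F)" "tgt (Src F) \<xi> = src (Src F) f" for \<xi>
    using that S.cmp_ide_left [of \<xi>] by (subst S.cmp_assoc [symmetric]) (simp_all add: gf)
  with \<chi> show "\<chi> = \<chi>'" by metis
qed (fact f)

lemma cartesian_ide: "E \<in> Ob (Src F) \<Longrightarrow> cartesian F (ide (Src F) E)"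
  using S.cmp_ide_left [of "ide (Src F) E"]
  by (intro cartesian_iso [of "ide (Src F) E" "ide (Src F) E"]) (simp_all add: functor_rules)

end

lemma fibre_simps [simp]:
  "Ob (fibre P A) = {E \<in> Ob (Src P). omap P E = A}"
  "Ar (fibre P A) = {e \<in> Ar (Src P). amap P e = ide (Tgt P) A}"
  "src (fibre P A) = src (Src P)" "tgt (fibre P A) = tgt (Src P)"
  "ide (fibre P A) = ide (Src P)" "cmp (fibre P A) = cmp (Src P)"
  by (simp_all add: fibre_def)

context is_functor
begin

lemma vertical_ends:
  assumes "e \<in> Ar (Src F)" "amap F e = ide (Tgt F) A" "A \<in> Ob (Tgt F)"
  shows "omap F (src (Src F) e) = A" "omap F (tgt (Src F) e) = A"
  using assms by (metis src_amap tgt_amap T.src_ide T.tgt_ide)+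

lemma category_fibre: "A \<in> Ob (Tgt F) \<Longrightarrow> category (fibre F A)"
  using T.cmp_ide_left [of "ide (Tgt F) A"]
  by unfold_locales (auto simp: functor_rules vertical_ends S.cmp_assoc)

end

section \<open>Reindexings along an arrow of the base and their comparison\<close>

text \<open>
  A functor between fibres together with a natural choice of Cartesian lifts of \<open>f\<close> whose
  domains are its values.  The inverse image functors of a cleavage are of this kind, but so are
  their composites \<open>f\<^sup>* g\<^sup>*\<close> (along \<open>g f\<close>) and the identity functor (along an identity).
  This puts the source and the target of each structure isomorphism on an equal footing.
\<close>

locale reindexing = P: is_functor P + F: is_functor F
  for P :: "('eo, 'ea, 'bo, 'ba) fnctr" and f :: 'ba
    and F :: "('eo, 'ea, 'eo, 'ea) fnctr" and l :: "'eo \<Rightarrow> 'ea" +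
  assumes base_arrow: "f \<in> Ar (Tgt P)"
    and Src_F: "Src F = fibre P (tgt (Tgt P) f)"
    and Tgt_F: "Tgt F = fibre P (src (Tgt P) f)"
    and lift: "\<lbrakk>E \<in> Ob (Src P); omap P E = tgt (Tgt P) f\<rbrakk> \<Longrightarrow> cartesian_lift P f E (l E)"
    and src_lift: "\<lbrakk>E \<in> Ob (Src P); omap P E = tgt (Tgt P) f\<rbrakk> \<Longrightarrow> src (Src P) (l E) = omap F E"
    and lift_natural: "\<lbrakk>e \<in> Ar (Src P); amap P e = ide (Tgt P) (tgt (Tgt P) f)\<rbrakk> \<Longrightarrow>
      l (tgt (Src P) e) \<cdot>\<^bsub>Src P\<^esub> amap F e = e \<cdot>\<^bsub>Src P\<^esub> l (src (Src P) e)"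
begin

lemma lift_cartesian: "\<lbrakk>E \<in> Ob (Src P); omap P E = tgt (Tgt P) f\<rbrakk> \<Longrightarrow> cartesian P (l E)"
  and tgt_lift: "\<lbrakk>E \<in> Ob (Src P); omap P E = tgt (Tgt P) f\<rbrakk> \<Longrightarrow> tgt (Src P) (l E) = E"
  and lift_over: "\<lbrakk>E \<in> Ob (Src P); omap P E = tgt (Tgt P) f\<rbrakk> \<Longrightarrow> amap P (l E) = f"
  and lift_arrow: "\<lbrakk>E \<in> Ob (Src P); omap P E = tgt (Tgt P) f\<rbrakk> \<Longrightarrow> l E \<in> Ar (Src P)"
  using lift [of E] by (auto simp: cartesian_lift_def P.cartesian_arrow)

lemma omap_over:
  "\<lbrakk>E \<in> Ob (Src P); omap P E = tgt (Tgt P) f\<rbrakk> \<Longrightarrow> omap F E \<in> Ob (Src P)"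
  "\<lbrakk>E \<in> Ob (Src P); omap P E = tgt (Tgt P) f\<rbrakk> \<Longrightarrow> omap P (omap F E) = src (Tgt P) f"
  using F.omap_in [of E] by (simp_all add: Src_F Tgt_F)

lemma amap_over:
  assumes "e \<in> Ar (Src P)" "amap P e = ide (Tgt P) (tgt (Tgt P) f)"
  shows "amap F e \<in> Ar (Src P)" "amap P (amap F e) = ide (Tgt P) (src (Tgt P) f)"
    "src (Src P) (amap F e) = omap F (src (Src P) e)" "tgt (Src P) (amap F e) = omap F (tgt (Src P) e)"
  using assms F.amap_in [of e] F.src_amap [of e] F.tgt_amap [of e] by (simp_all add: Src_F Tgt_F)

lemmas reindexing_rules = base_arrow lift_cartesian tgt_lift lift_over lift_arrow src_lift omap_over
  amap_over P.functor_rules P.vertical_ends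

end

lemma reindexing_id:
  assumes "is_functor P" "A \<in> Ob (Tgt P)"
  shows "reindexing P (ide (Tgt P) A) (id_fnctr (fibre P A)) (ide (Src P))"
proof -
  interpret P: is_functor P by fact
  show ?thesis
    using assms P.cartesian_ide
    by (auto intro!: reindexing.intro reindexing_axioms.intro is_functor_id P.category_fibre
        simp: P.functor_rules P.vertical_ends cartesian_lift_def)
qed

lemma reindexing_comp:
  assumes "reindexing P f F l" "reindexing P g G m" "tgt (Tgt P) f = src (Tgt P) g"
  shows "reindexing P (g \<cdot>\<^bsub>Tgt P\<^esub> f) (F \<circ>\<^sub>F G) (\<lambda>E. m E \<cdot>\<^bsub>Src P\<^esub> l (omap G E))"
proof -
  interpret F: reindexing P f F l by fact
  interpret G: reindexing P g G m by fact
  note [simp] = assms(3) F.reindexing_rules F.Src_F F.Tgt_F G.reindexing_rules G.Src_F G.Tgt_F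
  have "(m (tgt (Src P) e) \<cdot>\<^bsub>Src P\<^esub> l (omap G (tgt (Src P) e))) \<cdot>\<^bsub>Src P\<^esub> amap F (amap G e) =
      e \<cdot>\<^bsub>Src P\<^esub> m (src (Src P) e) \<cdot>\<^bsub>Src P\<^esub> l (omap G (src (Src P) e))"
    if e: "e \<in> Ar (Src P)" "amap P e = ide (Tgt P) (tgt (Tgt P) g)" for e
  proof -
    have "(m (tgt (Src P) e) \<cdot>\<^bsub>Src P\<^esub> l (omap G (tgt (Src P) e))) \<cdot>\<^bsub>Src P\<^esub> amap F (amap G e) =
        m (tgt (Src P) e) \<cdot>\<^bsub>Src P\<^esub> amap G e \<cdot>\<^bsub>Src P\<^esub> l (omap G (src (Src P) e))"
      using F.lift_natural [of "amap G e"] e by (subst F.P.S.cmp_assoc) simp_all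
    also have "\<dots> = (e \<cdot>\<^bsub>Src P\<^esub> m (src (Src P) e)) \<cdot>\<^bsub>Src P\<^esub> l (omap G (src (Src P) e))"
      using G.lift_natural [of e] e by (subst F.P.S.cmp_assoc [symmetric]) simp_all
    finally show ?thesis
      using e by (simp add: F.P.S.cmp_assoc)
  qed
  then show ?thesis
    by (auto intro!: reindexing.intro reindexing_axioms.intro is_functor_fcomp
        F.F.is_functor_axioms G.F.is_functor_axioms F.P.is_functor_axioms
        F.P.cartesian_comp simp: cartesian_lift_def)
qed

text \<open>
  The inverse image \<open>f\<^sup>* e\<close> is the only vertical arrow that makes the naturality square of the lifts
  commute. Functoriality follows: \<open>f\<^sup>* e' \<cdot> f\<^sup>* e\<close> and identities make the squares of \<open>e' \<cdot> e\<close>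
  and of identities commute.
\<close>

lemma reindexing_inverse_image:
  assumes "is_functor P" "cleavage P \<kappa>" "f \<in> Ar (Tgt P)"
  shows "reindexing P f (inverse_image P \<kappa> f) (\<kappa> f)"
proof -
  interpret P: is_functor P by fact
  let ?A = "src (Tgt P) f" and ?B = "tgt (Tgt P) f" and ?F = "inverse_image P \<kappa> f"
  have lift: "cartesian P (\<kappa> f E)" "tgt (Src P) (\<kappa> f E) = E" "amap P (\<kappa> f E) = f"
      "\<kappa> f E \<in> Ar (Src P)"
    if "E \<in> Ob (Src P)" "omap P E = ?B" for E
    using assms(2,3) that unfolding cleavage_def cartesian_lift_def by (auto simp: P.cartesian_arrow)
  have over: "omap P (src (Src P) (\<kappa> f E)) = ?A" if "E \<in> Ob (Src P)" "omap P E = ?B" for E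
    using lift [OF that] by (metis P.src_amap)
  note [simp] = assms(3) lift over P.functor_rules P.vertical_ends
  have omap: "omap ?F E = src (Src P) (\<kappa> f E)" if "E \<in> Ob (Src P)" "omap P E = ?B" for E
    using that by (simp add: inverse_image_def)
  have amap: "amap ?F e \<in> Ar (Src P)" "src (Src P) (amap ?F e) = omap ?F (src (Src P) e)"
    "tgt (Src P) (amap ?F e) = omap ?F (tgt (Src P) e)" "amap P (amap ?F e) = ide (Tgt P) ?A"
    "\<kappa> f (tgt (Src P) e) \<cdot>\<^bsub>Src P\<^esub> amap ?F e = e \<cdot>\<^bsub>Src P\<^esub> \<kappa> f (src (Src P) e)"
    if e: "e \<in> Ar (Src P)" "amap P e = ide (Tgt P) ?B" for e
  proof -
    have "amap ?F e = factor P (\<kappa> f (tgt (Src P) e)) (ide (Tgt P) ?A) (e \<cdot>\<^bsub>Src P\<^esub> \<kappa> f (src (Src P) e))"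
      using e by (simp add: inverse_image_def)
    moreover have "amap P (e \<cdot>\<^bsub>Src P\<^esub> \<kappa> f (src (Src P) e)) = amap P (\<kappa> f (tgt (Src P) e)) \<cdot>\<^bsub>Tgt P\<^esub> ide (Tgt P) ?A"
      using e by simp
    ultimately show "amap ?F e \<in> Ar (Src P)" "src (Src P) (amap ?F e) = omap ?F (src (Src P) e)"
      "tgt (Src P) (amap ?F e) = omap ?F (tgt (Src P) e)" "amap P (amap ?F e) = ide (Tgt P) ?A"
      "\<kappa> f (tgt (Src P) e) \<cdot>\<^bsub>Src P\<^esub> amap ?F e = e \<cdot>\<^bsub>Src P\<^esub> \<kappa> f (src (Src P) e)"
      using P.factor_cartesian [of "\<kappa> f (tgt (Src P) e)" "e \<cdot>\<^bsub>Src P\<^esub> \<kappa> f (src (Src P) e)" "ide (Tgt P) ?A"] e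
      by (simp_all add: omap)
  qed
  note [simp] = omap amap(1-4)
  have ide: "amap ?F (ide (Src P) E) = ide (Src P) (omap ?F E)" if E: "E \<in> Ob (Src P)" "omap P E = ?B" for E
    by (rule P.cartesian_cancel [of "\<kappa> f E"])
      (use E amap(5) [of "ide (Src P) E"] P.S.cmp_ide_left [of "\<kappa> f E"] P.S.cmp_ide_right [of "\<kappa> f E"] in simp_all)
  have cmp: "amap ?F (e' \<cdot>\<^bsub>Src P\<^esub> e) = amap ?F e' \<cdot>\<^bsub>Src P\<^esub> amap ?F e"
    if e: "e \<in> Ar (Src P)" "amap P e = ide (Tgt P) ?B" "e' \<in> Ar (Src P)" "amap P e' = ide (Tgt P) ?B"
      "tgt (Src P) e = src (Src P) e'" for e e'
  proof -
    have vertical: "ide (Tgt P) B \<cdot>\<^bsub>Tgt P\<^esub> ide (Tgt P) B = ide (Tgt P) B" if "B \<in> Ob (Tgt P)" for B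
      using P.T.cmp_ide_left [of "ide (Tgt P) B"] that by simp
    have "\<kappa> f (tgt (Src P) e') \<cdot>\<^bsub>Src P\<^esub> amap ?F e' \<cdot>\<^bsub>Src P\<^esub> amap ?F e =
        (e' \<cdot>\<^bsub>Src P\<^esub> \<kappa> f (src (Src P) e')) \<cdot>\<^bsub>Src P\<^esub> amap ?F e"
      using e amap(5) [of e'] by (subst P.S.cmp_assoc [symmetric]) simp_all
    also have "\<dots> = e' \<cdot>\<^bsub>Src P\<^esub> e \<cdot>\<^bsub>Src P\<^esub> \<kappa> f (src (Src P) e)"
      using e amap(5) [of e] by (subst P.S.cmp_assoc) simp_all
    also have "\<dots> = \<kappa> f (tgt (Src P) e') \<cdot>\<^bsub>Src P\<^esub> amap ?F (e' \<cdot>\<^bsub>Src P\<^esub> e)"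
      using e amap(5) [of "e' \<cdot>\<^bsub>Src P\<^esub> e"] by (simp add: P.S.cmp_assoc vertical)
    finally show ?thesis
      by - (rule P.cartesian_cancel [of "\<kappa> f (tgt (Src P) e')"]; use e in \<open>simp add: vertical\<close>)
  qed
  have [simp]: "Src ?F = fibre P ?B" "Tgt ?F = fibre P ?A"
    by (simp_all add: inverse_image_def)
  have "is_functor ?F"
    by (auto intro!: is_functor.intro is_functor_axioms.intro P.category_fibre simp: ide cmp)
      (auto simp: inverse_image_def)
  then show ?thesis
    by (auto intro!: reindexing.intro reindexing_axioms.intro P.is_functor_axioms
      simp: cartesian_lift_def amap(5))
qed

text \<open>
  For reindexings \<open>F\<close> and \<open>G\<close> along an arrow with source \<open>A\<close>, with lifts \<open>l\<close> and \<open>m\<close>: the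
  transformation \<open>F \<Rightarrow> G\<close> whose component at \<open>E\<close> is the vertical arrow that composes with \<open>m E\<close> to
  \<open>l E\<close>.
\<close>

definition comparison ::
  "('eo, 'ea, 'bo, 'ba) fnctr \<Rightarrow> 'bo \<Rightarrow> ('eo, 'ea, 'eo, 'ea) fnctr \<Rightarrow> ('eo \<Rightarrow> 'ea) \<Rightarrow>
    ('eo, 'ea, 'eo, 'ea) fnctr \<Rightarrow> ('eo \<Rightarrow> 'ea) \<Rightarrow> ('eo, 'ea, 'eo, 'ea) nattrans" where
  "comparison P A F l G m =
    \<lparr>nsrc = F, ntgt = G, comps = (\<lambda>E \<in> Ob (Src F). factor P (m E) (ide (Tgt P) A) (l E))\<rparr>"

lemma comparison_simps [simp]:
  "nsrc (comparison P A F l G m) = F" "ntgt (comparison P A F l G m) = G"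
  by (simp_all add: comparison_def)

locale reindexing_pair = F: reindexing P f F l + G: reindexing P f G m for P f F l G m
begin

abbreviation "c \<equiv> comparison P (src (Tgt P) f) F l G m"

lemma comparison_comps:
  assumes "E \<in> Ob (Src P)" "omap P E = tgt (Tgt P) f"
  shows "comps c E \<in> Ar (Src P)" "src (Src P) (comps c E) = omap F E"
    "tgt (Src P) (comps c E) = omap G E" "amap P (comps c E) = ide (Tgt P) (src (Tgt P) f)"
    "m E \<cdot>\<^bsub>Src P\<^esub> comps c E = l E"
proof -
  have "comps c E = factor P (m E) (ide (Tgt P) (src (Tgt P) f)) (l E)"
    using assms by (simp add: comparison_def F.Src_F)
  then show "comps c E \<in> Ar (Src P)" "src (Src P) (comps c E) = omap F E"
    "tgt (Src P) (comps c E) = omap G E" "amap P (comps c E) = ide (Tgt P) (src (Tgt P) f)"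
    "m E \<cdot>\<^bsub>Src P\<^esub> comps c E = l E"
    using assms F.P.factor_cartesian [of "m E" "l E" "ide (Tgt P) (src (Tgt P) f)"]
    by (simp_all add: F.reindexing_rules G.reindexing_rules)
qed

lemma transformation_comparison:
  "transformation (fibre P (tgt (Tgt P) f)) (fibre P (src (Tgt P) f)) c"
proof -
  note [simp] = comparison_comps(1-4) F.reindexing_rules G.reindexing_rules F.Src_F F.Tgt_F G.Src_F G.Tgt_F
  have "comps c (tgt (Src P) e) \<cdot>\<^bsub>Src P\<^esub> amap F e = amap G e \<cdot>\<^bsub>Src P\<^esub> comps c (src (Src P) e)"
    if e: "e \<in> Ar (Src P)" "amap P e = ide (Tgt P) (tgt (Tgt P) f)" for e
  proof -
    have "m (tgt (Src P) e) \<cdot>\<^bsub>Src P\<^esub> comps c (tgt (Src P) e) \<cdot>\<^bsub>Src P\<^esub> amap F e =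
        l (tgt (Src P) e) \<cdot>\<^bsub>Src P\<^esub> amap F e"
      using e comparison_comps(5) [of "tgt (Src P) e"] by (subst F.P.S.cmp_assoc [symmetric]) simp_all
    also have "\<dots> = e \<cdot>\<^bsub>Src P\<^esub> m (src (Src P) e) \<cdot>\<^bsub>Src P\<^esub> comps c (src (Src P) e)"
      using e comparison_comps(5) [of "src (Src P) e"] F.lift_natural [of e] by simp
    also have "\<dots> = (m (tgt (Src P) e) \<cdot>\<^bsub>Src P\<^esub> amap G e) \<cdot>\<^bsub>Src P\<^esub> comps c (src (Src P) e)"
      using e G.lift_natural [of e] by (subst F.P.S.cmp_assoc [symmetric]) simp_all
    also have "\<dots> = m (tgt (Src P) e) \<cdot>\<^bsub>Src P\<^esub> amap G e \<cdot>\<^bsub>Src P\<^esub> comps c (src (Src P) e)"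
      using e by (subst F.P.S.cmp_assoc) simp_all
    finally show ?thesis
      by - (rule F.P.cartesian_cancel [of "m (tgt (Src P) e)"]; use e in simp)
  qed
  then have "natural_transformation c"
    by (auto intro!: natural_transformation.intro natural_transformation_axioms.intro
        F.F.is_functor_axioms G.F.is_functor_axioms) (auto simp: comparison_def)
  then show ?thesis
    by (intro transformationI) simp_all
qed

text \<open>
  The source of all coherence: two transformations between reindexings that are compatible with
  the lifts agree, because the lifts are Cartesian.
\<close>

lemma comparison_unique:
  assumes "transformation (fibre P (tgt (Tgt P) f)) (fibre P (src (Tgt P) f)) \<alpha>" "nsrc \<alpha> = F" "ntgt \<alpha> = G"
    and compatible: "\<And>E. \<lbrakk>E \<in> Ob (Src P); omap P E = tgt (Tgt P) f\<rbrakk> \<Longrightarrow> m E \<cdot>\<^bsub>Src P\<^esub> comps \<alpha> E = l E"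
  shows "\<alpha> = c"
proof (rule transformation_eqI [OF assms(1) transformation_comparison])
  interpret \<alpha>: transformation "fibre P (tgt (Tgt P) f)" "fibre P (src (Tgt P) f)" \<alpha> by fact
  fix E assume "E \<in> Ob (fibre P (tgt (Tgt P) f))"
  then have E: "E \<in> Ob (Src P)" "omap P E = tgt (Tgt P) f" by simp_all
  then show "comps \<alpha> E = comps c E"
    using \<alpha>.comps_rules [of E] compatible [OF E] comparison_comps [OF E]
    by - (rule F.P.cartesian_cancel [of "m E"], simp_all add: assms(2,3) G.reindexing_rules)
qed (simp_all add: assms)

end

lemma vcomp_comparison:
  assumes "reindexing P f F l" "reindexing P f G m" "reindexing P f H n"
  shows "vcomp_nat (comparison P (src (Tgt P) f) G m H n) (comparison P (src (Tgt P) f) F l G m) =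
    comparison P (src (Tgt P) f) F l H n"
proof -
  interpret FG: reindexing_pair P f F l G m using assms by (simp add: reindexing_pair_def)
  interpret GH: reindexing_pair P f G m H n using assms by (simp add: reindexing_pair_def)
  interpret FH: reindexing_pair P f F l H n using assms by (simp add: reindexing_pair_def)
  note [simp] = FG.comparison_comps GH.comparison_comps GH.G.reindexing_rules
  show ?thesis
    by (rule FH.comparison_unique)
      (auto intro!: transformation_vcomp FG.transformation_comparison GH.transformation_comparison
        simp: FG.F.Src_F FG.F.Tgt_F FG.F.P.S.cmp_assoc [symmetric])
qed

lemma comparison_self:
  assumes "reindexing P f F l"
  shows "comparison P (src (Tgt P) f) F l F l = id_nat F"
proof -
  interpret reindexing_pair P f F l F l using assms by (simp add: reindexing_pair_def)
  have "l E \<cdot>\<^bsub>Src P\<^esub> ide (Src P) (omap F E) = l E" if "E \<in> Ob (Src P)" "omap P E = tgt (Tgt P) f" for E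
    using F.P.S.cmp_ide_right [of "l E"] that by (simp add: F.reindexing_rules)
  then show ?thesis
    by (intro comparison_unique [symmetric])
      (auto intro!: transformation_id F.F.is_functor_axioms simp: F.Src_F F.Tgt_F)
qed

text \<open>
  The lifts of a composite reindexing are the composites of lifts. A horizontal composite of
  comparisons is compatible with them because each factor is compatible with its own, once the
  lifts \<open>l\<close> are moved past the component of the second comparison by naturality.
\<close>

lemma hcomp_comparison:
  assumes F: "reindexing P f F l" and G: "reindexing P f G m"
    and F': "reindexing P g F' l'" and G': "reindexing P g G' m'"
    and fg: "tgt (Tgt P) f = src (Tgt P) g"
  shows "hcomp_nat (comparison P (src (Tgt P) f) F l G m) (comparison P (src (Tgt P) g) F' l' G' m') =
    comparison P (src (Tgt P) f) (F \<circ>\<^sub>F F') (\<lambda>E. l' E \<cdot>\<^bsub>Src P\<^esub> l (omap F' E))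
      (G \<circ>\<^sub>F G') (\<lambda>E. m' E \<cdot>\<^bsub>Src P\<^esub> m (omap G' E))"
proof -
  interpret a: reindexing_pair P f F l G m using assms by (simp add: reindexing_pair_def)
  interpret b: reindexing_pair P g F' l' G' m' using assms by (simp add: reindexing_pair_def)
  interpret ab: reindexing_pair P "g \<cdot>\<^bsub>Tgt P\<^esub> f" "F \<circ>\<^sub>F F'" "\<lambda>E. l' E \<cdot>\<^bsub>Src P\<^esub> l (omap F' E)"
    "G \<circ>\<^sub>F G'" "\<lambda>E. m' E \<cdot>\<^bsub>Src P\<^esub> m (omap G' E)"
    using assms by (simp add: reindexing_pair_def reindexing_comp)
  note [simp] = a.comparison_comps b.comparison_comps a.F.reindexing_rules a.G.reindexing_rules
    b.F.reindexing_rules b.G.reindexing_rules fg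
  have ends: "src (Tgt P) (g \<cdot>\<^bsub>Tgt P\<^esub> f) = src (Tgt P) f" "tgt (Tgt P) (g \<cdot>\<^bsub>Tgt P\<^esub> f) = tgt (Tgt P) g"
    by simp_all
  have "(m' E \<cdot>\<^bsub>Src P\<^esub> m (omap G' E)) \<cdot>\<^bsub>Src P\<^esub> comps a.c (omap G' E) \<cdot>\<^bsub>Src P\<^esub> amap F (comps b.c E) =
      l' E \<cdot>\<^bsub>Src P\<^esub> l (omap F' E)" if E: "E \<in> Ob (Src P)" "omap P E = tgt (Tgt P) g" for E
  proof -
    have "(m' E \<cdot>\<^bsub>Src P\<^esub> m (omap G' E)) \<cdot>\<^bsub>Src P\<^esub> comps a.c (omap G' E) \<cdot>\<^bsub>Src P\<^esub> amap F (comps b.c E) =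
        m' E \<cdot>\<^bsub>Src P\<^esub> (m (omap G' E) \<cdot>\<^bsub>Src P\<^esub> comps a.c (omap G' E)) \<cdot>\<^bsub>Src P\<^esub> amap F (comps b.c E)"
      using E by (simp add: a.F.P.S.cmp_assoc del: a.comparison_comps(5))
    also have "\<dots> = m' E \<cdot>\<^bsub>Src P\<^esub> comps b.c E \<cdot>\<^bsub>Src P\<^esub> l (omap F' E)"
      using E a.F.lift_natural [of "comps b.c E"] by simp
    also have "\<dots> = l' E \<cdot>\<^bsub>Src P\<^esub> l (omap F' E)"
      using E by (subst a.F.P.S.cmp_assoc [symmetric]) simp_all
    finally show ?thesis .
  qed
  then show ?thesis
    using transformation_hcomp [OF b.transformation_comparison a.transformation_comparison [unfolded fg]]
    by (intro ab.comparison_unique [unfolded ends])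
      (auto simp: a.F.Tgt_F b.F.Src_F)
qed

text \<open>
  Only the values of the lifts on the fibre matter. Composite reindexings that differ by bracketing
  have lifts which agree there, by associativity in the total category, but not as functions.
\<close>

lemma comparison_cong:
  "\<lbrakk>F = F'; G = G'; \<And>E. E \<in> Ob (Src F) \<Longrightarrow> l E = l' E; \<And>E. E \<in> Ob (Src F) \<Longrightarrow> m E = m' E\<rbrakk> \<Longrightarrow>
    comparison P A F l G m = comparison P A F' l' G' m'"
  by (auto simp: comparison_def)

section \<open>Coherence for the inverse image functors of a cleavage\<close>

locale cloven = is_functor P for P :: "('eo, 'ea, 'bo, 'ba) fnctr" +
  fixes \<kappa> :: "'ba \<Rightarrow> 'eo \<Rightarrow> 'ea"
  assumes cleavage: "cleavage P \<kappa>"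
begin

abbreviation "pullback \<equiv> inverse_image P \<kappa>"

lemmas reindexing_pullback = reindexing_inverse_image [OF is_functor_axioms cleavage]

lemma omap_pullback: "E \<in> Ob (fibre P (tgt (Tgt P) g)) \<Longrightarrow> omap (pullback g) E = src (Src P) (\<kappa> g E)"
  by (simp add: inverse_image_def)

lemma Src_pullback: "Src (pullback g) = fibre P (tgt (Tgt P) g)"
  by (simp add: inverse_image_def)

lemma reindexing_pullback_comp:
  assumes "f \<in> Ar (Tgt P)" "g \<in> Ar (Tgt P)" "tgt (Tgt P) f = src (Tgt P) g"
  shows "reindexing P (g \<cdot>\<^bsub>Tgt P\<^esub> f) (pullback f \<circ>\<^sub>F pullback g)
    (\<lambda>E. \<kappa> g E \<cdot>\<^bsub>Src P\<^esub> \<kappa> f (omap (pullback g) E))"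
  using assms by (intro reindexing_comp reindexing_pullback)

lemma inverse_image_mult_eq_comparison:
  assumes "f \<in> Ar (Tgt P)" "g \<in> Ar (Tgt P)" "tgt (Tgt P) f = src (Tgt P) g"
  shows "inverse_image_mult P \<kappa> f g = comparison P (src (Tgt P) f) (pullback f \<circ>\<^sub>F pullback g)
    (\<lambda>E. \<kappa> g E \<cdot>\<^bsub>Src P\<^esub> \<kappa> f (omap (pullback g) E)) (pullback (g \<cdot>\<^bsub>Tgt P\<^esub> f)) (\<kappa> (g \<cdot>\<^bsub>Tgt P\<^esub> f))"
  by (auto simp: inverse_image_mult_def comparison_def omap_pullback Src_pullback)

lemma inverse_image_unit_eq_comparison:
  "inverse_image_unit P \<kappa> A = comparison P A (id_fnctr (fibre P A)) (ide (Src P))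
    (pullback (ide (Tgt P) A)) (\<kappa> (ide (Tgt P) A))"
  by (simp add: inverse_image_unit_def comparison_def)

lemma id_pullback_eq_comparison:
  "f \<in> Ar (Tgt P) \<Longrightarrow>
    id_nat (pullback f) = comparison P (src (Tgt P) f) (pullback f) (\<kappa> f) (pullback f) (\<kappa> f)"
  using comparison_self [OF reindexing_pullback] by simp

text \<open>
  By closure under both compositions, each side is the comparison between the reindexings
  \<open>f\<^sup>* g\<^sup>* h\<^sup>*\<close> and \<open>(h g f)\<^sup>*\<close> along \<open>h g f\<close>.
\<close>

lemma inverse_image_mult_assoc:
  assumes f: "f \<in> Ar (Tgt P)" and g: "g \<in> Ar (Tgt P)" and h: "h \<in> Ar (Tgt P)"
    and fg: "tgt (Tgt P) f = src (Tgt P) g" and gh: "tgt (Tgt P) g = src (Tgt P) h"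
  shows "vcomp_nat (inverse_image_mult P \<kappa> f (h \<cdot>\<^bsub>Tgt P\<^esub> g))
      (hcomp_nat (id_nat (pullback f)) (inverse_image_mult P \<kappa> g h)) =
    vcomp_nat (inverse_image_mult P \<kappa> (g \<cdot>\<^bsub>Tgt P\<^esub> f) h)
      (hcomp_nat (inverse_image_mult P \<kappa> f g) (id_nat (pullback h)))"
proof -
  note [simp] = f g h fg gh functor_rules
  note eqs = inverse_image_mult_eq_comparison id_pullback_eq_comparison
  let ?l = "\<lambda>g h E. \<kappa> h E \<cdot>\<^bsub>Src P\<^esub> \<kappa> g (omap (pullback h) E)"
  let ?hgf = "h \<cdot>\<^bsub>Tgt P\<^esub> g \<cdot>\<^bsub>Tgt P\<^esub> f"
  have assoc: "(h \<cdot>\<^bsub>Tgt P\<^esub> g) \<cdot>\<^bsub>Tgt P\<^esub> f = ?hgf"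
    by (simp add: T.cmp_assoc)
  have rf: "reindexing P f (pullback f) (\<kappa> f)" and rh: "reindexing P h (pullback h) (\<kappa> h)"
    and rhg: "reindexing P (h \<cdot>\<^bsub>Tgt P\<^esub> g) (pullback (h \<cdot>\<^bsub>Tgt P\<^esub> g)) (\<kappa> (h \<cdot>\<^bsub>Tgt P\<^esub> g))"
    and rgf: "reindexing P (g \<cdot>\<^bsub>Tgt P\<^esub> f) (pullback (g \<cdot>\<^bsub>Tgt P\<^esub> f)) (\<kappa> (g \<cdot>\<^bsub>Tgt P\<^esub> f))"
    and rhgf: "reindexing P ?hgf (pullback ?hgf) (\<kappa> ?hgf)"
    by (simp_all add: reindexing_pullback)
  have rg_h: "reindexing P (h \<cdot>\<^bsub>Tgt P\<^esub> g) (pullback g \<circ>\<^sub>F pullback h) (?l g h)"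
    and rf_g: "reindexing P (g \<cdot>\<^bsub>Tgt P\<^esub> f) (pullback f \<circ>\<^sub>F pullback g) (?l f g)"
    by (simp_all add: reindexing_pullback_comp)
  interpret f: reindexing P f "pullback f" "\<kappa> f" by (fact rf)
  interpret h: reindexing P h "pullback h" "\<kappa> h" by (fact rh)
  interpret g: reindexing P g "pullback g" "\<kappa> g" by (simp add: reindexing_pullback)
  have "hcomp_nat (id_nat (pullback f)) (inverse_image_mult P \<kappa> g h) =
      comparison P (src (Tgt P) f) (pullback f \<circ>\<^sub>F pullback g \<circ>\<^sub>F pullback h)
        (\<lambda>E. ?l g h E \<cdot>\<^bsub>Src P\<^esub> \<kappa> f (omap (pullback g \<circ>\<^sub>F pullback h) E))
        (pullback f \<circ>\<^sub>F pullback (h \<cdot>\<^bsub>Tgt P\<^esub> g)) (?l f (h \<cdot>\<^bsub>Tgt P\<^esub> g))"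
    using hcomp_comparison [OF rf rf rg_h rhg] by (simp add: eqs)
  then have "vcomp_nat (inverse_image_mult P \<kappa> f (h \<cdot>\<^bsub>Tgt P\<^esub> g))
      (hcomp_nat (id_nat (pullback f)) (inverse_image_mult P \<kappa> g h)) =
    comparison P (src (Tgt P) f) (pullback f \<circ>\<^sub>F pullback g \<circ>\<^sub>F pullback h)
      (\<lambda>E. ?l g h E \<cdot>\<^bsub>Src P\<^esub> \<kappa> f (omap (pullback g \<circ>\<^sub>F pullback h) E)) (pullback ?hgf) (\<kappa> ?hgf)"
    using vcomp_comparison [OF reindexing_comp [OF rf rg_h] reindexing_comp [OF rf rhg], unfolded assoc, OF _ _ rhgf]
    by (simp add: eqs assoc)
  also have "\<dots> = comparison P (src (Tgt P) f) ((pullback f \<circ>\<^sub>F pullback g) \<circ>\<^sub>F pullback h)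
      (\<lambda>E. \<kappa> h E \<cdot>\<^bsub>Src P\<^esub> ?l f g (omap (pullback h) E)) (pullback ?hgf) (\<kappa> ?hgf)"
    by (rule comparison_cong)
      (auto intro!: fcomp_assoc [symmetric] f.F.is_functor_axioms g.F.is_functor_axioms h.F.is_functor_axioms
        simp: f.Src_F g.Src_F g.Tgt_F h.Src_F h.Tgt_F f.reindexing_rules g.reindexing_rules h.reindexing_rules S.cmp_assoc)
  also have "\<dots> = vcomp_nat (inverse_image_mult P \<kappa> (g \<cdot>\<^bsub>Tgt P\<^esub> f) h)
      (hcomp_nat (inverse_image_mult P \<kappa> f g) (id_nat (pullback h)))"
  proof -
    have "hcomp_nat (inverse_image_mult P \<kappa> f g) (id_nat (pullback h)) =
        comparison P (src (Tgt P) f) ((pullback f \<circ>\<^sub>F pullback g) \<circ>\<^sub>F pullback h)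
          (\<lambda>E. \<kappa> h E \<cdot>\<^bsub>Src P\<^esub> ?l f g (omap (pullback h) E))
          (pullback (g \<cdot>\<^bsub>Tgt P\<^esub> f) \<circ>\<^sub>F pullback h) (?l (g \<cdot>\<^bsub>Tgt P\<^esub> f) h)"
      using hcomp_comparison [OF rf_g rgf rh rh] by (simp add: eqs)
    then show ?thesis
      using vcomp_comparison [OF reindexing_comp [OF rf_g rh] reindexing_comp [OF rgf rh] rhgf]
      by (simp add: eqs)
  qed
  finally show ?thesis .
qed

text \<open>
  Each left-hand side is the comparison of \<open>f\<^sup>*\<close>, composed with an identity functor, with \<open>f\<^sup>*\<close>.
  The identity functor has identities as lifts, so this is the comparison of \<open>f\<^sup>*\<close> with itself.
\<close>

lemma inverse_image_mult_unit:
  assumes f: "f \<in> Ar (Tgt P)"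
  shows "vcomp_nat (inverse_image_mult P \<kappa> f (ide (Tgt P) (tgt (Tgt P) f)))
      (hcomp_nat (id_nat (pullback f)) (inverse_image_unit P \<kappa> (tgt (Tgt P) f))) = id_nat (pullback f)"
    and "vcomp_nat (inverse_image_mult P \<kappa> (ide (Tgt P) (src (Tgt P) f)) f)
      (hcomp_nat (inverse_image_unit P \<kappa> (src (Tgt P) f)) (id_nat (pullback f))) = id_nat (pullback f)"
proof -
  note [simp] = f functor_rules
  note eqs = inverse_image_mult_eq_comparison id_pullback_eq_comparison inverse_image_unit_eq_comparison
  let ?A = "src (Tgt P) f" and ?B = "tgt (Tgt P) f"
  have rf: "reindexing P f (pullback f) (\<kappa> f)"
    and rA: "reindexing P (ide (Tgt P) ?A) (pullback (ide (Tgt P) ?A)) (\<kappa> (ide (Tgt P) ?A))"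
    and rB: "reindexing P (ide (Tgt P) ?B) (pullback (ide (Tgt P) ?B)) (\<kappa> (ide (Tgt P) ?B))"
    by (simp_all add: reindexing_pullback)
  have idA: "reindexing P (ide (Tgt P) ?A) (id_fnctr (fibre P ?A)) (ide (Src P))"
    and idB: "reindexing P (ide (Tgt P) ?B) (id_fnctr (fibre P ?B)) (ide (Src P))"
    by (simp_all add: reindexing_id is_functor_axioms)
  interpret f: reindexing P f "pullback f" "\<kappa> f" by (fact rf)
  have unit: "ide (Src P) E \<cdot>\<^bsub>Src P\<^esub> \<kappa> f E = \<kappa> f E"
    "\<kappa> f E \<cdot>\<^bsub>Src P\<^esub> ide (Src P) (omap (pullback f) E) = \<kappa> f E" if "E \<in> Ob (Src P)" "omap P E = ?B" for E
    using S.cmp_ide_left [of "\<kappa> f E"] S.cmp_ide_right [of "\<kappa> f E"] that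
    by (simp_all add: f.reindexing_rules)
  have "hcomp_nat (id_nat (pullback f)) (inverse_image_unit P \<kappa> ?B) = comparison P ?A
      (pullback f \<circ>\<^sub>F id_fnctr (fibre P ?B)) (\<lambda>E. ide (Src P) E \<cdot>\<^bsub>Src P\<^esub> \<kappa> f (omap (id_fnctr (fibre P ?B)) E))
      (pullback f \<circ>\<^sub>F pullback (ide (Tgt P) ?B))
      (\<lambda>E. \<kappa> (ide (Tgt P) ?B) E \<cdot>\<^bsub>Src P\<^esub> \<kappa> f (omap (pullback (ide (Tgt P) ?B)) E))"
    using hcomp_comparison [OF rf rf idB rB] by (simp add: eqs)
  also have "\<dots> = comparison P ?A (pullback f) (\<kappa> f) (pullback f \<circ>\<^sub>F pullback (ide (Tgt P) ?B))
      (\<lambda>E. \<kappa> (ide (Tgt P) ?B) E \<cdot>\<^bsub>Src P\<^esub> \<kappa> f (omap (pullback (ide (Tgt P) ?B)) E))"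
    using fcomp_id(1) [OF f.F.is_functor_axioms] by (intro comparison_cong) (auto simp: f.Src_F unit)
  finally show "vcomp_nat (inverse_image_mult P \<kappa> f (ide (Tgt P) ?B))
      (hcomp_nat (id_nat (pullback f)) (inverse_image_unit P \<kappa> ?B)) = id_nat (pullback f)"
    using vcomp_comparison [OF rf reindexing_comp [OF rf rB, simplified] rf] by (simp add: eqs)
  have "hcomp_nat (inverse_image_unit P \<kappa> ?A) (id_nat (pullback f)) = comparison P ?A
      (id_fnctr (fibre P ?A) \<circ>\<^sub>F pullback f) (\<lambda>E. \<kappa> f E \<cdot>\<^bsub>Src P\<^esub> ide (Src P) (omap (pullback f) E))
      (pullback (ide (Tgt P) ?A) \<circ>\<^sub>F pullback f)
      (\<lambda>E. \<kappa> f E \<cdot>\<^bsub>Src P\<^esub> \<kappa> (ide (Tgt P) ?A) (omap (pullback f) E))"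
    using hcomp_comparison [OF idA rA rf rf] by (simp add: eqs)
  also have "\<dots> = comparison P ?A (pullback f) (\<kappa> f) (pullback (ide (Tgt P) ?A) \<circ>\<^sub>F pullback f)
      (\<lambda>E. \<kappa> f E \<cdot>\<^bsub>Src P\<^esub> \<kappa> (ide (Tgt P) ?A) (omap (pullback f) E))"
    using fcomp_id(2) [OF f.F.is_functor_axioms] by (intro comparison_cong) (auto simp: f.Src_F f.Tgt_F unit)
  finally show "vcomp_nat (inverse_image_mult P \<kappa> (ide (Tgt P) ?A) f)
      (hcomp_nat (inverse_image_unit P \<kappa> ?A) (id_nat (pullback f))) = id_nat (pullback f)"
    using vcomp_comparison [OF rf reindexing_comp [OF rA rf, simplified] rf] by (simp add: eqs)
qed

end

section \<open>A composable pair of fibrations\<close>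

locale composable_fibrations = P: fibration P + Q: fibration Q
  for P :: "('do, 'da, 'bo, 'ba) fnctr" and Q :: "('eo, 'ea, 'do, 'da) fnctr" +
  assumes Tgt_Q [simp]: "Tgt Q = Src P"
begin

lemmas Q_rules = Q.functor_rules [unfolded Tgt_Q]

abbreviation "PQ \<equiv> P \<circ>\<^sub>F Q"

sublocale PQ: is_functor PQ
  by (intro is_functor_fcomp P.is_functor_axioms Q.is_functor_axioms) simp

text \<open>
  An arrow \<open>\<psi>\<close> over \<open>h\<close> is factored in two stages: the factorization of \<open>Q \<psi>\<close> through \<open>Q \<phi>\<close> over \<open>h\<close>
  is the arrow over which \<open>\<psi>\<close> factors through \<open>\<phi>\<close>.
\<close>

lemma cartesian_composite:
  assumes \<phi>: "cartesian Q \<phi>" and Q\<phi>: "cartesian P (amap Q \<phi>)"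
  shows "cartesian PQ \<phi>"
proof (rule PQ.cartesianI)
  note [simp] = Q_rules P.functor_rules Q.cartesian_arrow [OF \<phi>]
  show "\<phi> \<in> Ar (Src PQ)" by simp
  { fix \<psi> h assume "\<psi> \<in> Ar (Src PQ)" "h \<in> Ar (Tgt PQ)" "tgt (Src PQ) \<psi> = tgt (Src PQ) \<phi>"
      "src (Tgt PQ) h = omap PQ (src (Src PQ) \<psi>)" "tgt (Tgt PQ) h = omap PQ (src (Src PQ) \<phi>)"
      "amap PQ \<psi> = amap PQ \<phi> \<cdot>\<^bsub>Tgt PQ\<^esub> h"
    then have \<psi>: "\<psi> \<in> Ar (Src Q)" "h \<in> Ar (Tgt P)" "tgt (Src Q) \<psi> = tgt (Src Q) \<phi>"
      "src (Tgt P) h = omap P (omap Q (src (Src Q) \<psi>))" "tgt (Tgt P) h = omap P (omap Q (src (Src Q) \<phi>))"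
      "amap P (amap Q \<psi>) = amap P (amap Q \<phi>) \<cdot>\<^bsub>Tgt P\<^esub> h"
      by simp_all
    let ?d = "factor P (amap Q \<phi>) h (amap Q \<psi>)"
    have d: "?d \<in> Ar (Src P)" "src (Src P) ?d = src (Src P) (amap Q \<psi>)" "tgt (Src P) ?d = src (Src P) (amap Q \<phi>)"
      "amap P ?d = h" "amap Q \<phi> \<cdot>\<^bsub>Src P\<^esub> ?d = amap Q \<psi>"
      using \<psi> by (intro P.factor_cartesian [OF Q\<phi>]; simp)+
    let ?\<chi> = "factor Q \<phi> ?d \<psi>"
    have "?\<chi> \<in> Ar (Src Q)" "src (Src Q) ?\<chi> = src (Src Q) \<psi>" "tgt (Src Q) ?\<chi> = src (Src Q) \<phi>"
      "amap Q ?\<chi> = ?d" "\<phi> \<cdot>\<^bsub>Src Q\<^esub> ?\<chi> = \<psi>"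
      using \<psi> d by (intro Q.factor_cartesian [OF \<phi>]; simp)+
    with d show "\<exists>\<chi>. \<chi> \<in> Ar (Src PQ) \<and> src (Src PQ) \<chi> = src (Src PQ) \<psi> \<and> tgt (Src PQ) \<chi> = src (Src PQ) \<phi> \<and>
        amap PQ \<chi> = h \<and> \<phi> \<cdot>\<^bsub>Src PQ\<^esub> \<chi> = \<psi>"
      by (intro exI [of _ ?\<chi>]) simp }
  fix \<chi> \<chi>' assume "\<chi> \<in> Ar (Src PQ)" "tgt (Src PQ) \<chi> = src (Src PQ) \<phi>"
    "\<chi>' \<in> Ar (Src PQ)" "tgt (Src PQ) \<chi>' = src (Src PQ) \<phi>"
    "src (Src PQ) \<chi> = src (Src PQ) \<chi>'" "amap PQ \<chi> = amap PQ \<chi>'" "\<phi> \<cdot>\<^bsub>Src PQ\<^esub> \<chi> = \<phi> \<cdot>\<^bsub>Src PQ\<^esub> \<chi>'"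
  then have \<chi>: "\<chi> \<in> Ar (Src Q)" "tgt (Src Q) \<chi> = src (Src Q) \<phi>"
    "\<chi>' \<in> Ar (Src Q)" "tgt (Src Q) \<chi>' = src (Src Q) \<phi>"
    "src (Src Q) \<chi> = src (Src Q) \<chi>'" "amap P (amap Q \<chi>) = amap P (amap Q \<chi>')" "\<phi> \<cdot>\<^bsub>Src Q\<^esub> \<chi> = \<phi> \<cdot>\<^bsub>Src Q\<^esub> \<chi>'"
    by simp_all
  have "amap Q \<phi> \<cdot>\<^bsub>Src P\<^esub> amap Q \<chi> = amap Q \<phi> \<cdot>\<^bsub>Src P\<^esub> amap Q \<chi>'"
    using arg_cong [OF \<chi>(7), of "amap Q"] \<chi>(1-6) by simp
  with \<chi> have "amap Q \<chi> = amap Q \<chi>'"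
    by - (rule P.cartesian_cancel [OF Q\<phi>]; simp)
  with \<chi> show "\<chi> = \<chi>'"
    by - (rule Q.cartesian_cancel [OF \<phi>]; simp)
qed

abbreviation "restr \<equiv> fibre_restriction P Q"

lemma restr_simps [simp]:
  "Src (restr A) = fibre PQ A" "Tgt (restr A) = fibre P A"
  "\<lbrakk>E \<in> Ob (Src Q); omap P (omap Q E) = A\<rbrakk> \<Longrightarrow> omap (restr A) E = omap Q E"
  "\<lbrakk>e \<in> Ar (Src Q); amap P (amap Q e) = ide (Tgt P) A\<rbrakk> \<Longrightarrow> amap (restr A) e = amap Q e"
  by (simp_all add: fibre_restriction_def)

lemma vertical_ends:
  assumes "e \<in> Ar (Src Q)" "amap P (amap Q e) = ide (Tgt P) A" "A \<in> Ob (Tgt P)"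
  shows "omap P (omap Q (src (Src Q) e)) = A" "omap P (omap Q (tgt (Src Q) e)) = A"
  using PQ.vertical_ends [of e A] assms by (simp_all add: Q_rules)

lemma is_functor_restr:
  assumes "A \<in> Ob (Tgt P)"
  shows "is_functor (restr A)"
proof -
  have "ide (Tgt P) A \<cdot>\<^bsub>Tgt P\<^esub> ide (Tgt P) A = ide (Tgt P) A"
    using P.T.cmp_ide_left [of "ide (Tgt P) A"] assms by (simp add: P.functor_rules)
  then show ?thesis
    using P.category_fibre [OF assms] PQ.category_fibre assms
    by (auto intro!: is_functor.intro is_functor_axioms.intro
        simp: Q_rules P.functor_rules vertical_ends assms)
      (auto simp: fibre_restriction_def extensional_def)
qed

text \<open>
  A factorization over an arrow that is vertical for \<open>P\<close> is itself vertical for \<open>P \<circ>\<^sub>F Q\<close>, so it stays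
  in the fibre.
\<close>

lemma cartesian_restrI:
  assumes A: "A \<in> Ob (Tgt P)" and \<phi>: "cartesian Q \<phi>" "amap P (amap Q \<phi>) = ide (Tgt P) A"
  shows "cartesian (restr A) \<phi>"
proof -
  note [simp] = Q_rules P.functor_rules Q.cartesian_arrow [OF \<phi>(1)] \<phi>(2) vertical_ends A
  interpret R: is_functor "restr A" using A by (rule is_functor_restr)
  show ?thesis
  proof (rule R.cartesianI)
    show "\<phi> \<in> Ar (Src (restr A))" by simp
    { fix \<psi> h assume "\<psi> \<in> Ar (Src (restr A))" "h \<in> Ar (Tgt (restr A))" "tgt (Src (restr A)) \<psi> = tgt (Src (restr A)) \<phi>"
        "src (Tgt (restr A)) h = omap (restr A) (src (Src (restr A)) \<psi>)"
        "tgt (Tgt (restr A)) h = omap (restr A) (src (Src (restr A)) \<phi>)"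
        "amap (restr A) \<psi> = amap (restr A) \<phi> \<cdot>\<^bsub>Tgt (restr A)\<^esub> h"
      then have \<psi>: "\<psi> \<in> Ar (Src Q)" "amap P (amap Q \<psi>) = ide (Tgt P) A" "h \<in> Ar (Src P)" "amap P h = ide (Tgt P) A"
        "tgt (Src Q) \<psi> = tgt (Src Q) \<phi>" "src (Src P) h = omap Q (src (Src Q) \<psi>)"
        "tgt (Src P) h = omap Q (src (Src Q) \<phi>)" "amap Q \<psi> = amap Q \<phi> \<cdot>\<^bsub>Src P\<^esub> h"
        by auto
      let ?\<chi> = "factor Q \<phi> h \<psi>"
      have "?\<chi> \<in> Ar (Src Q)" "src (Src Q) ?\<chi> = src (Src Q) \<psi>" "tgt (Src Q) ?\<chi> = src (Src Q) \<phi>"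
        "amap Q ?\<chi> = h" "\<phi> \<cdot>\<^bsub>Src Q\<^esub> ?\<chi> = \<psi>"
        using \<psi> by (intro Q.factor_cartesian [OF \<phi>(1)]; simp)+
      with \<psi> show "\<exists>\<chi>. \<chi> \<in> Ar (Src (restr A)) \<and> src (Src (restr A)) \<chi> = src (Src (restr A)) \<psi> \<and>
          tgt (Src (restr A)) \<chi> = src (Src (restr A)) \<phi> \<and> amap (restr A) \<chi> = h \<and> \<phi> \<cdot>\<^bsub>Src (restr A)\<^esub> \<chi> = \<psi>"
        by (intro exI [of _ ?\<chi>]) simp }
    fix \<chi> \<chi>' assume "\<chi> \<in> Ar (Src (restr A))" "tgt (Src (restr A)) \<chi> = src (Src (restr A)) \<phi>"
      "\<chi>' \<in> Ar (Src (restr A))" "tgt (Src (restr A)) \<chi>' = src (Src (restr A)) \<phi>"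
      "src (Src (restr A)) \<chi> = src (Src (restr A)) \<chi>'" "amap (restr A) \<chi> = amap (restr A) \<chi>'"
      "\<phi> \<cdot>\<^bsub>Src (restr A)\<^esub> \<chi> = \<phi> \<cdot>\<^bsub>Src (restr A)\<^esub> \<chi>'"
    then show "\<chi> = \<chi>'"
      by - (rule Q.cartesian_cancel [OF \<phi>(1)]; auto)
  qed
qed

lemma restr_lift:
  assumes A: "A \<in> Ob (Tgt P)" and f: "f \<in> Ar (Src P)" "amap P f = ide (Tgt P) A"
    and E: "E \<in> Ob (Src Q)" "omap Q E = tgt (Src P) f"
  obtains \<phi> where "cartesian Q \<phi>" "\<phi> \<in> Ar (Src Q)" "tgt (Src Q) \<phi> = E" "amap Q \<phi> = f" "cartesian (restr A) \<phi>"
proof -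
  obtain \<phi> where "cartesian_lift Q f E \<phi>"
    using Q.ex_cartesian_lift [of f E] f E by auto
  then have "cartesian Q \<phi>" "tgt (Src Q) \<phi> = E" "amap Q \<phi> = f"
    by (simp_all add: cartesian_lift_def)
  with that f show ?thesis
    using cartesian_restrI [OF A, of \<phi>] Q.cartesian_arrow by metis
qed

lemma fibration_restr:
  assumes A: "A \<in> Ob (Tgt P)"
  shows "fibration (restr A)"
proof -
  have "\<exists>\<phi>. cartesian_lift (restr A) f E \<phi>"
    if "f \<in> Ar (fibre P A)" "E \<in> Ob (fibre PQ A)" "omap (restr A) E = tgt (fibre P A) f" for f E
  proof -
    from that have fE: "f \<in> Ar (Src P)" "amap P f = ide (Tgt P) A" "E \<in> Ob (Src Q)" "omap Q E = tgt (Src P) f"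
      by auto
    from restr_lift [OF A this] obtain \<phi>
      where "\<phi> \<in> Ar (Src Q)" "tgt (Src Q) \<phi> = E" "amap Q \<phi> = f" "cartesian (restr A) \<phi>" .
    with fE show ?thesis
      by (auto simp: cartesian_lift_def)
  qed
  then show ?thesis
    by (auto intro!: fibration.intro fibration_axioms.intro is_functor_restr A)
qed

text \<open>
  The converse needs that \<open>Q\<close> is a fibration. A \<open>Q\<close>-Cartesian lift \<open>\<theta>\<close> of \<open>Q \<phi>\<close> is Cartesian in the
  fibre too, so \<open>\<phi>\<close> and \<open>\<theta>\<close> are two Cartesian lifts there and differ by an isomorphism.
\<close>

lemma cartesian_restrD:
  assumes A: "A \<in> Ob (Tgt P)" and \<phi>: "cartesian (restr A) \<phi>"
  shows "cartesian Q \<phi>"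
proof -
  interpret R: is_functor "restr A" using A by (rule is_functor_restr)
  from R.cartesian_arrow [OF \<phi>] have arr [simp]: "\<phi> \<in> Ar (Src Q)" "amap P (amap Q \<phi>) = ide (Tgt P) A"
    by auto
  note [simp] = Q_rules P.functor_rules vertical_ends A
  obtain \<theta> where \<theta>: "cartesian Q \<theta>" "\<theta> \<in> Ar (Src Q)" "tgt (Src Q) \<theta> = tgt (Src Q) \<phi>" "amap Q \<theta> = amap Q \<phi>"
    "cartesian (restr A) \<theta>"
    using restr_lift [OF A, of "amap Q \<phi>" "tgt (Src Q) \<phi>"] by auto
  have ends: "omap Q (src (Src Q) \<theta>) = omap Q (src (Src Q) \<phi>)"
    using \<theta>(2,4) Q_rules(3) [of \<theta>] Q_rules(3) [of \<phi>] by simp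
  let ?i = "ide (Src P) (omap Q (src (Src Q) \<phi>))"
  \<comment> \<open>\<open>\<phi>\<close> is known to be Cartesian in the fibre only, so \<open>\<theta>\<close> is factored through \<open>\<phi>\<close> there.\<close>
  let ?\<chi> = "factor Q \<theta> ?i \<phi>" and ?\<xi> = "factor (restr A) \<phi> ?i \<theta>"
  have \<chi>: "?\<chi> \<in> Ar (Src Q)" "src (Src Q) ?\<chi> = src (Src Q) \<phi>" "tgt (Src Q) ?\<chi> = src (Src Q) \<theta>"
    "amap Q ?\<chi> = ?i" "\<theta> \<cdot>\<^bsub>Src Q\<^esub> ?\<chi> = \<phi>"
    using \<theta> ends P.S.cmp_ide_right [of "amap Q \<phi>"] by (intro Q.factor_cartesian [OF \<theta>(1)]; simp)+
  have \<xi>: "?\<xi> \<in> Ar (fibre PQ A)" "src (Src Q) ?\<xi> = src (Src Q) \<theta>" "tgt (Src Q) ?\<xi> = src (Src Q) \<phi>"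
    "amap (restr A) ?\<xi> = ?i" "\<phi> \<cdot>\<^bsub>Src Q\<^esub> ?\<xi> = \<theta>"
    using R.factor_cartesian [OF \<phi>, of \<theta> ?i] \<theta> ends P.S.cmp_ide_right [of "amap Q \<phi>"]
    by simp_all
  then have \<xi>': "?\<xi> \<in> Ar (Src Q)" "amap Q ?\<xi> = ?i"
    by auto
  have "cartesian Q ?\<chi>"
  proof (rule Q.cartesian_iso)
    have vertical: "?i \<cdot>\<^bsub>Src P\<^esub> ?i = ?i"
      using P.S.cmp_ide_left [of ?i] by simp
    have "\<phi> \<cdot>\<^bsub>Src Q\<^esub> ?\<xi> \<cdot>\<^bsub>Src Q\<^esub> ?\<chi> = \<phi>"
      using \<chi> \<xi> \<xi>' by (subst Q.S.cmp_assoc [symmetric]) simp_all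
    then show "?\<xi> \<cdot>\<^bsub>Src Q\<^esub> ?\<chi> = ide (Src Q) (src (Src Q) ?\<chi>)"
      using \<chi> \<xi> \<xi>' \<theta>
      by - (rule R.cartesian_cancel [OF \<phi>]; simp add: vertical)
    have "\<theta> \<cdot>\<^bsub>Src Q\<^esub> ?\<chi> \<cdot>\<^bsub>Src Q\<^esub> ?\<xi> = \<theta>"
      using \<chi> \<xi> \<xi>' \<theta> by (subst Q.S.cmp_assoc [symmetric]) simp_all
    then show "?\<chi> \<cdot>\<^bsub>Src Q\<^esub> ?\<xi> = ide (Src Q) (tgt (Src Q) ?\<chi>)"
      using \<chi> \<xi> \<xi>' \<theta> ends
      by - (rule Q.cartesian_cancel [OF \<theta>(1)]; simp add: vertical)
  qed (use \<chi> \<xi> \<xi>' in simp_all)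
  then show ?thesis
    using Q.cartesian_comp [OF _ \<theta>(1), of ?\<chi>] \<chi> by simp
qed

end

section \<open>Inverse image squares\<close>

text \<open>
  A reindexing of \<open>P \<circ>\<^sub>F Q\<close> over a reindexing of \<open>P\<close>, with lifts lying over lifts.  That the
  lifts in the total category are Cartesian for \<open>Q\<close> as well is what makes the square preserve
  Cartesian arrows.
\<close>

locale fibred_reindexing = composable_fibrations P Q +
  T: reindexing "P \<circ>\<^sub>F Q" f "total H" l + B: reindexing P f "base H" k
  for P :: "('do, 'da, 'bo, 'ba) fnctr" and Q :: "('eo, 'ea, 'do, 'da) fnctr" and f :: 'ba
    and H :: "('eo, 'ea, 'do, 'da) fib_mor" and l :: "'eo \<Rightarrow> 'ea" and k :: "'do \<Rightarrow> 'da" +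
  assumes msrc: "msrc H = fibre_restriction P Q (tgt (Tgt P) f)"
    and mtgt: "mtgt H = fibre_restriction P Q (src (Tgt P) f)"
    and lift_Q_cartesian: "\<lbrakk>E \<in> Ob (Src Q); omap P (omap Q E) = tgt (Tgt P) f\<rbrakk> \<Longrightarrow> cartesian Q (l E)"
    and lifts_over: "\<lbrakk>E \<in> Ob (Src Q); omap P (omap Q E) = tgt (Tgt P) f\<rbrakk> \<Longrightarrow> amap Q (l E) = k (omap Q E)"
begin

lemma total_lift:
  assumes "E \<in> Ob (Src Q)" "omap P (omap Q E) = tgt (Tgt P) f"
  shows "l E \<in> Ar (Src Q)" "tgt (Src Q) (l E) = E" "src (Src Q) (l E) = omap (total H) E"
    "omap (total H) E \<in> Ob (Src Q)" "omap P (omap Q (omap (total H) E)) = src (Tgt P) f"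
  using assms T.lift_arrow [of E] T.tgt_lift [of E] T.src_lift [of E] T.omap_over [of E] by simp_all

lemma total_amap:
  assumes "e \<in> Ar (Src Q)" "amap P (amap Q e) = ide (Tgt P) (tgt (Tgt P) f)"
  shows "amap (total H) e \<in> Ar (Src Q)"
    "amap P (amap Q (amap (total H) e)) = ide (Tgt P) (src (Tgt P) f)"
    "src (Src Q) (amap (total H) e) = omap (total H) (src (Src Q) e)"
    "tgt (Src Q) (amap (total H) e) = omap (total H) (tgt (Src Q) e)"
    "l (tgt (Src Q) e) \<cdot>\<^bsub>Src Q\<^esub> amap (total H) e = e \<cdot>\<^bsub>Src Q\<^esub> l (src (Src Q) e)"
  using assms T.amap_over [of e] T.lift_natural [of e] by simp_all

lemmas fibred_rules = T.base_arrow [simplified] total_lift total_amap(1-4) lifts_over vertical_ends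
  Q_rules B.reindexing_rules

lemma square_omap:
  assumes "E \<in> Ob (Src Q)" "omap P (omap Q E) = tgt (Tgt P) f"
  shows "omap Q (omap (total H) E) = omap (base H) (omap Q E)"
proof -
  note [simp] = assms fibred_rules
  have "omap Q (omap (total H) E) = src (Src P) (amap Q (l E))"
    using Q_rules(3) [of "l E"] by (simp del: lifts_over Q_rules(3))
  then show ?thesis
    by simp
qed

text \<open>
  Both sides make the naturality square of the lifts \<open>k\<close> at \<open>Q e\<close> commute; for the left-hand side this
  is the image under \<open>Q\<close> of the naturality square of the lifts \<open>l\<close> at \<open>e\<close>.
\<close>

lemma square_amap:
  assumes e: "e \<in> Ar (Src Q)" "amap P (amap Q e) = ide (Tgt P) (tgt (Tgt P) f)"
  shows "amap Q (amap (total H) e) = amap (base H) (amap Q e)"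
proof -
  note [simp] = fibred_rules square_omap e
  have "k (omap Q (tgt (Src Q) e)) \<cdot>\<^bsub>Src P\<^esub> amap Q (amap (total H) e) =
      amap Q (l (tgt (Src Q) e) \<cdot>\<^bsub>Src Q\<^esub> amap (total H) e)"
    by simp
  also have "\<dots> = amap Q e \<cdot>\<^bsub>Src P\<^esub> k (omap Q (src (Src Q) e))"
    unfolding total_amap(5) [OF e] by simp
  also have "\<dots> = k (omap Q (tgt (Src Q) e)) \<cdot>\<^bsub>Src P\<^esub> amap (base H) (amap Q e)"
    using B.lift_natural [of "amap Q e"] by simp
  finally show ?thesis
    by - (rule P.cartesian_cancel [of "k (omap Q (tgt (Src Q) e))"]; simp)
qed

text \<open>
  In the naturality square of the lifts at \<open>\<phi>\<close>, all arrows other than the image of \<open>\<phi>\<close> are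
  \<open>Q\<close>-Cartesian, hence so is that one.
\<close>

lemma preserves_cartesian:
  assumes \<phi>: "cartesian (restr (tgt (Tgt P) f)) \<phi>"
  shows "cartesian (restr (src (Tgt P) f)) (amap (total H) \<phi>)"
proof (rule cartesian_restrI)
  note [simp] = fibred_rules
  show "src (Tgt P) f \<in> Ob (Tgt P)" by simp
  have \<phi>': "cartesian Q \<phi>"
    using \<phi> by (rule cartesian_restrD [rotated]) simp
  have [simp]: "\<phi> \<in> Ar (Src Q)" "amap P (amap Q \<phi>) = ide (Tgt P) (tgt (Tgt P) f)"
    using \<phi> by (auto simp: cartesian_def)
  have "cartesian Q (\<phi> \<cdot>\<^bsub>Src Q\<^esub> l (src (Src Q) \<phi>))"
    by (intro Q.cartesian_comp \<phi>' lift_Q_cartesian) simp_all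
  then have "cartesian Q (l (tgt (Src Q) \<phi>) \<cdot>\<^bsub>Src Q\<^esub> amap (total H) \<phi>)"
    by (simp add: total_amap(5))
  then show "cartesian Q (amap (total H) \<phi>)"
    by (rule Q.cartesian_right_factor [rotated 3]) (simp_all add: lift_Q_cartesian)
  show "amap P (amap Q (amap (total H) \<phi>)) = ide (Tgt P) (src (Tgt P) f)"
    by simp
qed

lemma cartesian_morphism: "cartesian_morphism H"
proof -
  note [simp] = fibred_rules msrc mtgt T.Src_F T.Tgt_F B.Src_F B.Tgt_F square_omap square_amap
  show ?thesis
    by (rule cartesian_morphismI)
      (auto intro!: fibration_restr preserves_cartesian T.F.is_functor_axioms B.F.is_functor_axioms)
qed

end

lemma fibred_reindexing_comp:
  assumes "fibred_reindexing P Q f H l k" "fibred_reindexing P Q g K m n" "tgt (Tgt P) f = src (Tgt P) g"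
  shows "fibred_reindexing P Q (g \<cdot>\<^bsub>Tgt P\<^esub> f) (comp_fib_mor H K)
    (\<lambda>E. m E \<cdot>\<^bsub>Src Q\<^esub> l (omap (total K) E)) (\<lambda>D. n D \<cdot>\<^bsub>Src P\<^esub> k (omap (base K) D))"
proof -
  interpret H: fibred_reindexing P Q f H l k by fact
  interpret K: fibred_reindexing P Q g K m n by fact
  note [simp] = H.fibred_rules K.fibred_rules assms(3) K.square_omap
  have "reindexing (P \<circ>\<^sub>F Q) (g \<cdot>\<^bsub>Tgt P\<^esub> f) (total (comp_fib_mor H K)) (\<lambda>E. m E \<cdot>\<^bsub>Src Q\<^esub> l (omap (total K) E))"
    using reindexing_comp [OF H.T.reindexing_axioms K.T.reindexing_axioms] by simp
  moreover have "reindexing P (g \<cdot>\<^bsub>Tgt P\<^esub> f) (base (comp_fib_mor H K)) (\<lambda>D. n D \<cdot>\<^bsub>Src P\<^esub> k (omap (base K) D))"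
    using reindexing_comp [OF H.B.reindexing_axioms K.B.reindexing_axioms] by simp
  ultimately show ?thesis
    by (auto intro!: fibred_reindexing.intro fibred_reindexing_axioms.intro H.composable_fibrations_axioms
        H.Q.cartesian_comp H.lift_Q_cartesian K.lift_Q_cartesian simp: H.mtgt K.msrc)
qed

context composable_fibrations
begin

lemma fibred_reindexing_id:
  assumes A: "A \<in> Ob (Tgt P)"
  shows "fibred_reindexing P Q (ide (Tgt P) A) (id_fib_mor (restr A)) (ide (Src Q)) (ide (Src P))"
  using reindexing_id [OF PQ.is_functor_axioms, of A] reindexing_id [OF P.is_functor_axioms, of A] A
  by (auto intro!: fibred_reindexing.intro fibred_reindexing_axioms.intro composable_fibrations_axioms
      Q.cartesian_ide simp: Q_rules P.functor_rules)

definition comparison_cell where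
  "comparison_cell A H l k K m n =
    \<lparr>csrc = H, ctgt = K, ctotal = comparison PQ A (total H) l (total K) m,
     cbase = comparison P A (base H) k (base K) n\<rparr>"

lemma comparison_cell_simps [simp]:
  "csrc (comparison_cell A H l k K m n) = H" "ctgt (comparison_cell A H l k K m n) = K"
  "ctotal (comparison_cell A H l k K m n) = comparison PQ A (total H) l (total K) m"
  "cbase (comparison_cell A H l k K m n) = comparison P A (base H) k (base K) n"
  by (simp_all add: comparison_cell_def)

text \<open>
  The image under \<open>Q\<close> of a comparison in the total category is compatible with the lifts below,
  and hence is the comparison there.
\<close>

lemma fibred_cell_comparison:
  assumes "fibred_reindexing P Q f H l k" "fibred_reindexing P Q f K m n"
  shows "fibred_cell (comparison_cell (src (Tgt P) f) H l k K m n)"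
proof -
  interpret H: fibred_reindexing P Q f H l k by fact
  interpret K: fibred_reindexing P Q f K m n by fact
  interpret t: reindexing_pair PQ f "total H" l "total K" m
    by (simp add: reindexing_pair_def H.T.reindexing_axioms K.T.reindexing_axioms)
  interpret b: reindexing_pair P f "base H" k "base K" n
    by (simp add: reindexing_pair_def H.B.reindexing_axioms K.B.reindexing_axioms)
  let ?t = "comparison PQ (src (Tgt P) f) (total H) l (total K) m"
  note [simp] = H.fibred_rules K.fibred_rules b.comparison_comps(1-4)
  have t: "comps ?t E \<in> Ar (Src Q)" "src (Src Q) (comps ?t E) = omap (total H) E"
    "tgt (Src Q) (comps ?t E) = omap (total K) E"
    "amap P (amap Q (comps ?t E)) = ide (Tgt P) (src (Tgt P) f)"
    "m E \<cdot>\<^bsub>Src Q\<^esub> comps ?t E = l E"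
    if "E \<in> Ob (Src Q)" "omap P (omap Q E) = tgt (Tgt P) f" for E
    using t.comparison_comps [of E] that by simp_all
  note [simp] = t(1-4)
  have "amap Q (comps ?t E) = comps b.c (omap Q E)" if E: "E \<in> Ob (Src Q)" "omap P (omap Q E) = tgt (Tgt P) f" for E
  proof -
    note [simp] = E
    have "n (omap Q E) \<cdot>\<^bsub>Src P\<^esub> amap Q (comps ?t E) = amap Q (m E \<cdot>\<^bsub>Src Q\<^esub> comps ?t E)"
      by simp
    also have "\<dots> = n (omap Q E) \<cdot>\<^bsub>Src P\<^esub> comps b.c (omap Q E)"
      using b.comparison_comps(5) [of "omap Q E"] by (simp add: t(5) del: Q_rules(6))
    finally show ?thesis
      by - (rule P.cartesian_cancel [of "n (omap Q E)"]; simp add: H.square_omap K.square_omap)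
  qed
  then show ?thesis
    using t.transformation_comparison b.transformation_comparison
    by (intro fibred_cellI) (auto simp: H.msrc H.mtgt K.msrc K.mtgt
        intro!: H.cartesian_morphism K.cartesian_morphism)
qed

text \<open>
  The comparison in the opposite direction is inverse, since the composites are comparisons of a
  reindexing with itself.
\<close>

lemma iso_comparison_cell:
  assumes "fibred_reindexing P Q f H l k" "fibred_reindexing P Q f K m n"
  shows "iso_arrow (cells2 FIBc) (comparison_cell (src (Tgt P) f) H l k K m n)"
proof -
  have inverse: "vcomp_fib_cell (comparison_cell (src (Tgt P) f) K m n H l k)
      (comparison_cell (src (Tgt P) f) H l k K m n) = id_fib_cell H"
    if "fibred_reindexing P Q f H l k" "fibred_reindexing P Q f K m n" for H l k K m n
  proof -
    interpret H: fibred_reindexing P Q f H l k by fact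
    interpret K: fibred_reindexing P Q f K m n by fact
    show ?thesis
      using vcomp_comparison [OF H.T.reindexing_axioms K.T.reindexing_axioms H.T.reindexing_axioms]
        vcomp_comparison [OF H.B.reindexing_axioms K.B.reindexing_axioms H.B.reindexing_axioms]
        comparison_self [OF H.T.reindexing_axioms] comparison_self [OF H.B.reindexing_axioms]
      by (auto intro!: fib_cell.equality)
  qed
  show ?thesis
    unfolding iso_arrow_def
    using fibred_cell_comparison [OF assms] fibred_cell_comparison [OF assms(2,1)]
      inverse [OF assms] inverse [OF assms(2,1)]
    by (auto simp: FIBc_def intro!: bexI [of _ "comparison_cell (src (Tgt P) f) K m n H l k"])
qed

end

section \<open>The pseudo-functor of inverse image squares\<close>

locale cloven_pair = composable_fibrations P Q
  for P :: "('do, 'da, 'bo, 'ba) fnctr" and Q :: "('eo, 'ea, 'do, 'da) fnctr" +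
  fixes \<kappa>P :: "'ba \<Rightarrow> 'do \<Rightarrow> 'da" and \<kappa>Q :: "'da \<Rightarrow> 'eo \<Rightarrow> 'ea"
  assumes cleavage_P: "cleavage P \<kappa>P" and cleavage_Q: "cleavage Q \<kappa>Q"
begin

abbreviation "\<kappa> \<equiv> composite_cleavage Q \<kappa>P \<kappa>Q"
abbreviation "square \<equiv> inverse_image_square P \<kappa>P Q \<kappa>Q"

lemma cleavage_lifts:
  assumes "f \<in> Ar (Tgt P)" "E \<in> Ob (Src Q)" "omap P (omap Q E) = tgt (Tgt P) f"
  shows "cartesian P (\<kappa>P f (omap Q E))" "amap P (\<kappa>P f (omap Q E)) = f"
    "cartesian Q (\<kappa> f E)" "tgt (Src Q) (\<kappa> f E) = E" "amap Q (\<kappa> f E) = \<kappa>P f (omap Q E)"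
proof -
  have P: "cartesian_lift P f (omap Q E) (\<kappa>P f (omap Q E))"
    using cleavage_P assms by (simp add: cleavage_def Q_rules)
  then show "cartesian P (\<kappa>P f (omap Q E))" "amap P (\<kappa>P f (omap Q E)) = f"
    by (simp_all add: cartesian_lift_def)
  have "cartesian_lift Q (\<kappa>P f (omap Q E)) E (\<kappa> f E)"
    using cleavage_Q P assms by (simp add: cleavage_def composite_cleavage_def cartesian_lift_def P.cartesian_arrow)
  then show "cartesian Q (\<kappa> f E)" "tgt (Src Q) (\<kappa> f E) = E" "amap Q (\<kappa> f E) = \<kappa>P f (omap Q E)"
    by (simp_all add: cartesian_lift_def)
qed

lemma cleavage_composite: "cleavage PQ \<kappa>"
  unfolding cleavage_def cartesian_lift_def
  using cleavage_lifts Q.cartesian_arrow by (auto intro!: cartesian_composite)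

sublocale cP: cloven P \<kappa>P
  by unfold_locales (fact cleavage_P)

sublocale cPQ: cloven PQ \<kappa>
  by unfold_locales (fact cleavage_composite)

lemma square_simps [simp]:
  "msrc (square f) = restr (tgt (Tgt P) f)" "mtgt (square f) = restr (src (Tgt P) f)"
  "total (square f) = cPQ.pullback f" "base (square f) = cP.pullback f"
  by (simp_all add: inverse_image_square_def)

lemma fibred_reindexing_square:
  assumes "f \<in> Ar (Tgt P)"
  shows "fibred_reindexing P Q f (square f) (\<kappa> f) (\<kappa>P f)"
  using cPQ.reindexing_pullback [of f] cP.reindexing_pullback [OF assms] assms cleavage_lifts [OF assms]
  by (auto intro!: fibred_reindexing.intro fibred_reindexing_axioms.intro composable_fibrations_axioms)

lemma fibred_reindexing_square_comp:
  assumes "f \<in> Ar (Tgt P)" "g \<in> Ar (Tgt P)" "tgt (Tgt P) f = src (Tgt P) g"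
  shows "fibred_reindexing P Q (g \<cdot>\<^bsub>Tgt P\<^esub> f) (comp_fib_mor (square f) (square g))
    (\<lambda>E. \<kappa> g E \<cdot>\<^bsub>Src Q\<^esub> \<kappa> f (omap (cPQ.pullback g) E))
    (\<lambda>D. \<kappa>P g D \<cdot>\<^bsub>Src P\<^esub> \<kappa>P f (omap (cP.pullback g) D))"
  using fibred_reindexing_comp [OF fibred_reindexing_square fibred_reindexing_square] assms by simp

lemma mult_Xi_eq_comparison_cell:
  assumes "f \<in> Ar (Tgt P)" "g \<in> Ar (Tgt P)" "tgt (Tgt P) f = src (Tgt P) g"
  shows "mult (Xi P \<kappa>P Q \<kappa>Q) f g = comparison_cell (src (Tgt P) f)
    (comp_fib_mor (square f) (square g)) (\<lambda>E. \<kappa> g E \<cdot>\<^bsub>Src Q\<^esub> \<kappa> f (omap (cPQ.pullback g) E))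
    (\<lambda>D. \<kappa>P g D \<cdot>\<^bsub>Src P\<^esub> \<kappa>P f (omap (cP.pullback g) D))
    (square (g \<cdot>\<^bsub>Tgt P\<^esub> f)) (\<kappa> (g \<cdot>\<^bsub>Tgt P\<^esub> f)) (\<kappa>P (g \<cdot>\<^bsub>Tgt P\<^esub> f))"
  using assms cP.inverse_image_mult_eq_comparison [of f g] cPQ.inverse_image_mult_eq_comparison [of f g]
  by (simp add: Xi_def comparison_cell_def)

lemma unit_Xi_eq_comparison_cell:
  "unit (Xi P \<kappa>P Q \<kappa>Q) A = comparison_cell A
    (id_fib_mor (restr A)) (ide (Src Q)) (ide (Src P))
    (square (ide (Tgt P) A)) (\<kappa> (ide (Tgt P) A)) (\<kappa>P (ide (Tgt P) A))"
  using cP.inverse_image_unit_eq_comparison [of A] cPQ.inverse_image_unit_eq_comparison [of A]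
  by (simp add: Xi_def comparison_cell_def)

text \<open>
  The squares of \<open>f\<close> and \<open>g\<close> compose to a fibred reindexing along \<open>g f\<close>, and so does the square of
  \<open>g f\<close>; the multiplication is their comparison.
\<close>

lemma cells_Xi:
  assumes "f \<in> Ar (Tgt P)" "g \<in> Ar (Tgt P)" "tgt (Tgt P) f = src (Tgt P) g"
  shows "fibred_cell (mult (Xi P \<kappa>P Q \<kappa>Q) f g)" "iso_arrow (cells2 FIBc) (mult (Xi P \<kappa>P Q \<kappa>Q) f g)"
proof -
  have r: "fibred_reindexing P Q (g \<cdot>\<^bsub>Tgt P\<^esub> f) (square (g \<cdot>\<^bsub>Tgt P\<^esub> f)) (\<kappa> (g \<cdot>\<^bsub>Tgt P\<^esub> f)) (\<kappa>P (g \<cdot>\<^bsub>Tgt P\<^esub> f))"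
    and src: "src (Tgt P) (g \<cdot>\<^bsub>Tgt P\<^esub> f) = src (Tgt P) f"
    using assms by (simp_all add: fibred_reindexing_square P.functor_rules)
  show "fibred_cell (mult (Xi P \<kappa>P Q \<kappa>Q) f g)" "iso_arrow (cells2 FIBc) (mult (Xi P \<kappa>P Q \<kappa>Q) f g)"
    using fibred_cell_comparison [OF fibred_reindexing_square_comp [OF assms] r]
      iso_comparison_cell [OF fibred_reindexing_square_comp [OF assms] r]
    by (simp_all add: mult_Xi_eq_comparison_cell [OF assms] src)
qed

lemma iso_unit_Xi:
  assumes "A \<in> Ob (Tgt P)"
  shows "iso_arrow (cells2 FIBc) (unit (Xi P \<kappa>P Q \<kappa>Q) A)"
  using iso_comparison_cell [OF fibred_reindexing_id [OF assms] fibred_reindexing_square] assms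
  by (simp add: unit_Xi_eq_comparison_cell P.functor_rules)

lemma Xi_simps [simp]:
  "on_ob (Xi P \<kappa>P Q \<kappa>Q) = restr" "on_1 (Xi P \<kappa>P Q \<kappa>Q) = square"
  "on_2 (Xi P \<kappa>P Q \<kappa>Q) f = id_fib_cell (square f)"
  "csrc (mult (Xi P \<kappa>P Q \<kappa>Q) f g) = comp_fib_mor (square f) (square g)"
  "ctgt (mult (Xi P \<kappa>P Q \<kappa>Q) f g) = square (g \<cdot>\<^bsub>Tgt P\<^esub> f)"
  "ctotal (mult (Xi P \<kappa>P Q \<kappa>Q) f g) = inverse_image_mult PQ \<kappa> f g"
  "cbase (mult (Xi P \<kappa>P Q \<kappa>Q) f g) = inverse_image_mult P \<kappa>P f g"
  "csrc (unit (Xi P \<kappa>P Q \<kappa>Q) A) = id_fib_mor (restr A)"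
  "ctgt (unit (Xi P \<kappa>P Q \<kappa>Q) A) = square (ide (Tgt P) A)"
  "ctotal (unit (Xi P \<kappa>P Q \<kappa>Q) A) = inverse_image_unit PQ \<kappa> A"
  "cbase (unit (Xi P \<kappa>P Q \<kappa>Q) A) = inverse_image_unit P \<kappa>P A"
  by (simp_all add: Xi_def)

lemma cartesian_morphism_square: "f \<in> Ar (Tgt P) \<Longrightarrow> cartesian_morphism (square f)"
  by (rule fibred_reindexing.cartesian_morphism [OF fibred_reindexing_square])

lemma mult_Xi_natural:
  assumes "f \<in> Ar (Tgt P)" "g \<in> Ar (Tgt P)" "tgt (Tgt P) f = src (Tgt P) g"
  shows "vcomp_fib_cell (id_fib_cell (square (g \<cdot>\<^bsub>Tgt P\<^esub> f))) (mult (Xi P \<kappa>P Q \<kappa>Q) f g) =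
    vcomp_fib_cell (mult (Xi P \<kappa>P Q \<kappa>Q) f g) (hcomp_fib_cell (id_fib_cell (square f)) (id_fib_cell (square g)))"
  using vcomp_fib_cell_id [OF cells_Xi(1) [OF assms]] assms
  by (simp add: hcomp_fib_cell_id cartesian_morphism_square)

text \<open>
  Equality of fibred cells is tested in the total and in the base category; there it is coherence
  for the two cleavages.
\<close>

lemma mult_Xi_assoc:
  assumes f: "f \<in> Ar (Tgt P)" and g: "g \<in> Ar (Tgt P)" and h: "h \<in> Ar (Tgt P)"
    and fg: "tgt (Tgt P) f = src (Tgt P) g" and gh: "tgt (Tgt P) g = src (Tgt P) h"
  shows "vcomp_fib_cell (mult (Xi P \<kappa>P Q \<kappa>Q) f (h \<cdot>\<^bsub>Tgt P\<^esub> g))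
      (hcomp_fib_cell (id_fib_cell (square f)) (mult (Xi P \<kappa>P Q \<kappa>Q) g h)) =
    vcomp_fib_cell (mult (Xi P \<kappa>P Q \<kappa>Q) (g \<cdot>\<^bsub>Tgt P\<^esub> f) h)
      (hcomp_fib_cell (mult (Xi P \<kappa>P Q \<kappa>Q) f g) (id_fib_cell (square h)))"
  using cP.inverse_image_mult_assoc [OF assms] cPQ.inverse_image_mult_assoc [of f g h] assms
    comp_fib_mor_assoc [of "square h" "square g" "square f"]
  by (auto intro!: fib_cell.equality simp: cartesian_morphism_square P.T.cmp_assoc)

lemma mult_Xi_unit:
  assumes "f \<in> Ar (Tgt P)"
  shows "vcomp_fib_cell (mult (Xi P \<kappa>P Q \<kappa>Q) f (ide (Tgt P) (tgt (Tgt P) f)))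
      (hcomp_fib_cell (id_fib_cell (square f)) (unit (Xi P \<kappa>P Q \<kappa>Q) (tgt (Tgt P) f))) = id_fib_cell (square f)"
    and "vcomp_fib_cell (mult (Xi P \<kappa>P Q \<kappa>Q) (ide (Tgt P) (src (Tgt P) f)) f)
      (hcomp_fib_cell (unit (Xi P \<kappa>P Q \<kappa>Q) (src (Tgt P) f)) (id_fib_cell (square f))) = id_fib_cell (square f)"
  using cP.inverse_image_mult_unit [OF assms] cPQ.inverse_image_mult_unit [of f] assms
    comp_fib_mor_id [OF cartesian_morphism_square [OF assms]]
  by (auto intro!: fib_cell.equality simp: P.T.cmp_ide_left P.T.cmp_ide_right)

end

lemma two_category_locally_discrete:
  assumes "category C"
  shows "two_category (locally_discrete C)"
proof -
  interpret category C by fact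
  have "category (cells2 (locally_discrete C))"
    by unfold_locales (auto simp: locally_discrete_def)
  moreover have "category (horizontal_cat (locally_discrete C))"
    by unfold_locales
      (auto simp: horizontal_cat_def locally_discrete_def src_in tgt_in ide_in src_ide tgt_ide
        cmp_in src_cmp tgt_cmp cmp_ide_left cmp_ide_right cmp_assoc)
  ultimately show ?thesis
    by (intro two_category.intro two_category_axioms.intro)
      (auto simp: locally_discrete_def category_axioms)
qed

lemma category_opposite:
  assumes "category C"
  shows "category (opposite C)"
proof -
  interpret category C by fact
  show ?thesis
    by unfold_locales
      (auto simp: opposite_def src_in tgt_in ide_in src_ide tgt_ide cmp_in src_cmp tgt_cmp
        cmp_ide_left cmp_ide_right cmp_assoc)
qed

theorem proposition2p1p47:
  fixes P :: "('do, 'da, 'bo, 'ba) fnctr" and Q :: "('eo, 'ea, 'do, 'da) fnctr"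
    and \<kappa>P :: "'ba \<Rightarrow> 'do \<Rightarrow> 'da" and \<kappa>Q :: "'da \<Rightarrow> 'eo \<Rightarrow> 'ea"
  assumes "fibration P" and "fibration Q" and "Tgt Q = Src P"
    and "cleavage P \<kappa>P" and "cleavage Q \<kappa>Q"
  shows "pseudo_functor (locally_discrete (opposite (Tgt P))) FIBc (Xi P \<kappa>P Q \<kappa>Q)"
proof -
  interpret cloven_pair P Q \<kappa>P \<kappa>Q
    using assms by (simp add: cloven_pair_def cloven_pair_axioms_def composable_fibrations_def
        composable_fibrations_axioms_def)
  have on_2: "vcomp_fib_cell (id_fib_cell (square f)) (id_fib_cell (square f)) = id_fib_cell (square f)"
    if "f \<in> Ar (Tgt P)" for f
    using vcomp_fib_cell_id(1) [OF fibred_cell_id [OF cartesian_morphism_square [OF that]]] by simp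
  note simps = locally_discrete_def opposite_def FIBc_def
  show ?thesis
    using cells_Xi(2) iso_unit_Xi
    by (intro pseudo_functor.intro pseudo_functor_axioms.intro two_category_FIBc
        two_category_locally_discrete category_opposite P.T.category_axioms)
      (simp_all add: simps fibration_restr cartesian_morphism_square fibred_cell_id on_2
        mult_Xi_natural mult_Xi_assoc mult_Xi_unit P.functor_rules)
qed

end
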